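(* Assume that the Multiplicativity of cost-1 problem has an affirmative solution, i.e. that for every countable group $\Delta$, every essentially free measure-preserving Borel action of $\Delta$ on a standard Borel probability space $(X,\mu)$ and every subgroup $H\le\Delta$ of finite index, $$\mathrm{cost}(H,X)-1=(\mathrm{cost}(\Delta,X)-1)\,|\Delta:H| .$$ Let $\Gamma$ be a finitely generated group and let $(\Gamma_n)$ be a Farber chain in $\Gamma$. Then $$\mathrm{RG}(\Gamma,(\Gamma_n))=\mathrm{RG}(\Gamma).$$ In particular, any two Farber chains in $\Gamma$ have the same rank gradient.
   Context: A chain in a finitely generated group $\Gamma$ is a sequence $\Gamma=\Gamma_0\ge\Gamma_1\ge\Gamma_2\ge\dots$ of subgroups of finite index. The coset tree $T=T(\Gamma,(\Gamma_n))$ is the rooted tree whose vertices of level $n$ are the right cosets $\Gamma_n g$ ($g\in\Gamma$), with an edge from $\Gamma_n g$ to $\Gamma_{n+1}g$ for all $n\ge 0$, $g\in\Gamma$. Its boundary $\partial T$ is the set of infinite rays starting from the root. For a vertex $t=\Gamma_n g$ of level $n$, the shadow $\mathrm{Sh}(t)\subseteq\partial T$ is the set of rays passing through $t$; the shadows form a base of the topology of $\partial T$, and $\mu$ is the Borel probability measure on $\partial T$ with $\mu(\mathrm{Sh}(t))=1/|\Gamma:\Gamma_n|$. $\Gamma$ acts on $T$ by right multiplication on cosets, and hence on $\partial T$ by measure-preserving homeomorphisms. The chain is Farber if this action on $\partial T$ is essentially free, i.e. $\mu$-almost every point has trivial stabilizer in $\Gamma$. $d(G)$ is the minimal number of generators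 of a group $G$. The rank gradient of the chain is $\mathrm{RG}(\Gamma,(\Gamma_n))=\lim_{n\to\infty}\frac{d(\Gamma_n)-1}{|\Gamma:\Gamma_n|}$ (the sequence is non-increasing). The absolute rank gradient is $\mathrm{RG}(\Gamma)=\inf_H\frac{d(H)-1}{|\Gamma:H|}$, with $H$ running over all subgroups of finite index in $\Gamma$. Let a countable group $\Delta$ act on the right on a standard Borel space $X$ by Borel automorphisms preserving a probability measure $\mu$, with finitely many ergodic components. The orbit relation is $E=\{(x,y)\in X\times X: y=x\cdot\delta \text{ for some }\delta\in\Delta\}$. A Borel subgraph $S$ of $E$ is a directed graph on $X$ whose edge set is a Borel subset of $E$. It spans $E$ if any $(x,y)\in E$ with $x\neq y$ are joined by a finite path in $S$, where edges may be traversed in either direction. Its edge-measure is $e(S)=\int_X \deg_S(x)\,d\mu$ with $\deg_S(x)=|\{y\in X:(x,y)\in S\}|$. The cost is $\mathrm{cost}(\Delta,X)=\inf e(S)$ over all Borel subgraphs $S$ of $E$ that span $E$. For $H\le\Delta$, $\mathrm{cost}(H,X)$ is the cost of the restricted action of $H$ on $X$. *)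

theory Defs
  imports "HOL-Probability.Probability" "HOL-Algebra.Generated_Groups"
begin

section \<open>Rank gradient\<close>

definition finitely_generated :: "('a, 'b) monoid_scheme \<Rightarrow> bool" where
  "finitely_generated G \<longleftrightarrow>
     (\<exists>S. finite S \<and> S \<subseteq> carrier G \<and> generate G S = carrier G)"

text \<open>Only meaningful for finitely generated groups.\<close>

definition min_generators :: "('a, 'b) monoid_scheme \<Rightarrow> nat" where
  "min_generators G =
     (LEAST k. \<exists>S. finite S \<and> S \<subseteq> carrier G \<and> generate G S = carrier G \<and> card S = k)"

definition finite_index :: "('a, 'b) monoid_scheme \<Rightarrow> 'a set \<Rightarrow> bool" where
  "finite_index G H \<longleftrightarrow> subgroup H G \<and> finite (rcosets\<^bsub>G\<^esub> H)"

definition subgroup_index :: "('a, 'b) monoid_scheme \<Rightarrow> 'a set \<Rightarrow> nat" where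
  "subgroup_index G H = card (rcosets\<^bsub>G\<^esub> H)"

text \<open>The numerator is a real subtraction, so the trivial subgroup contributes \<open>-1\<close>, not \<open>0\<close>.\<close>

definition rank_quotient :: "('a, 'b) monoid_scheme \<Rightarrow> 'a set \<Rightarrow> real" where
  "rank_quotient G H =
     (real (min_generators (G\<lparr>carrier := H\<rparr>)) - 1) / real (subgroup_index G H)"

definition is_chain :: "('a, 'b) monoid_scheme \<Rightarrow> (nat \<Rightarrow> 'a set) \<Rightarrow> bool" where
  "is_chain G \<Gamma> \<longleftrightarrow>
     \<Gamma> 0 = carrier G \<and> (\<forall>n. finite_index G (\<Gamma> n)) \<and> (\<forall>n. \<Gamma> (Suc n) \<subseteq> \<Gamma> n)"

definition rank_gradient :: "('a, 'b) monoid_scheme \<Rightarrow> (nat \<Rightarrow> 'a set) \<Rightarrow> real" where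
  "rank_gradient G \<Gamma> = lim (\<lambda>n. rank_quotient G (\<Gamma> n))"

definition absolute_rank_gradient :: "('a, 'b) monoid_scheme \<Rightarrow> real" where
  "absolute_rank_gradient G = (INF H\<in>{H. finite_index G H}. rank_quotient G H)"


section \<open>Measure-preserving right actions\<close>

definition standard_borel :: "'x measure \<Rightarrow> bool" where
  "standard_borel M \<longleftrightarrow>
     (\<exists>T. completely_metrizable_space T \<and> second_countable T \<and> topspace T = space M \<and>
          sets M = sigma_sets (topspace T) {U. openin T U})"

definition right_action ::
    "('g, 'b) monoid_scheme \<Rightarrow> 'x set \<Rightarrow> ('x \<Rightarrow> 'g \<Rightarrow> 'x) \<Rightarrow> bool" where
  "right_action D X act \<longleftrightarrow>
     (\<forall>x\<in>X. \<forall>g\<in>carrier D. act x g \<in> X) \<and>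
     (\<forall>x\<in>X. act x \<one>\<^bsub>D\<^esub> = x) \<and>
     (\<forall>x\<in>X. \<forall>g\<in>carrier D. \<forall>h\<in>carrier D. act x (g \<otimes>\<^bsub>D\<^esub> h) = act (act x g) h)"

text \<open>The maps \<open>x \<mapsto> act x g\<close> are automorphisms because the inverse map belongs to \<open>inv g\<close>.\<close>

definition pmp_action ::
    "('g, 'b) monoid_scheme \<Rightarrow> 'x measure \<Rightarrow> ('x \<Rightarrow> 'g \<Rightarrow> 'x) \<Rightarrow> bool" where
  "pmp_action D M act \<longleftrightarrow>
     prob_space M \<and> right_action D (space M) act \<and>
     (\<forall>g\<in>carrier D. (\<lambda>x. act x g) \<in> M \<rightarrow>\<^sub>M M \<and> distr M M (\<lambda>x. act x g) = M)"

definition essentially_free ::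
    "('g, 'b) monoid_scheme \<Rightarrow> 'x measure \<Rightarrow> ('x \<Rightarrow> 'g \<Rightarrow> 'x) \<Rightarrow> bool" where
  "essentially_free D M act \<longleftrightarrow>
     (AE x in M. {g \<in> carrier D. act x g = x} = {\<one>\<^bsub>D\<^esub>})"

definition invariant_sets ::
    "('g, 'b) monoid_scheme \<Rightarrow> 'x measure \<Rightarrow> ('x \<Rightarrow> 'g \<Rightarrow> 'x) \<Rightarrow> 'x set set" where
  "invariant_sets D M act =
     {A \<in> sets M. \<forall>g\<in>carrier D. \<forall>x\<in>space M. act x g \<in> A \<longleftrightarrow> x \<in> A}"

text \<open>Up to a null set, the space is a finite disjoint union of invariant Borel sets of positive
  measure on each of which the action is ergodic.\<close>

definition finitely_many_ergodic_components ::
    "('g, 'b) monoid_scheme \<Rightarrow> 'x measure \<Rightarrow> ('x \<Rightarrow> 'g \<Rightarrow> 'x) \<Rightarrow> bool" where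
  "finitely_many_ergodic_components D M act \<longleftrightarrow>
     (\<exists>\<C>. finite \<C> \<and> disjoint \<C> \<and> \<C> \<subseteq> invariant_sets D M act \<and>
          emeasure M (space M - \<Union>\<C>) = 0 \<and>
          (\<forall>C\<in>\<C>. emeasure M C \<noteq> 0 \<and>
             (\<forall>A\<in>invariant_sets D M act. emeasure M (C \<inter> A) = 0 \<or> emeasure M (C - A) = 0)))"


section \<open>Cost\<close>

definition orbit_rel ::
    "('g, 'b) monoid_scheme \<Rightarrow> 'x measure \<Rightarrow> ('x \<Rightarrow> 'g \<Rightarrow> 'x) \<Rightarrow> ('x \<times> 'x) set" where
  "orbit_rel D M act =
     {(x, y). x \<in> space M \<and> y \<in> space M \<and> (\<exists>g\<in>carrier D. y = act x g)}"

definition borel_subgraph :: "'x measure \<Rightarrow> ('x \<times> 'x) set \<Rightarrow> ('x \<times> 'x) set \<Rightarrow> bool" where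
  "borel_subgraph M E S \<longleftrightarrow> S \<subseteq> E \<and> S \<in> sets (M \<Otimes>\<^sub>M M)"

definition spans :: "('x \<times> 'x) set \<Rightarrow> ('x \<times> 'x) set \<Rightarrow> bool" where
  "spans S E \<longleftrightarrow> (\<forall>(x, y)\<in>E. x \<noteq> y \<longrightarrow> (x, y) \<in> (S \<union> S\<inverse>)\<^sup>*)"

text \<open>The counting measure makes the out-degree \<open>\<infinity>\<close> when there are infinitely many edges.\<close>

definition out_degree :: "('x \<times> 'x) set \<Rightarrow> 'x \<Rightarrow> ennreal" where
  "out_degree S x = emeasure (count_space UNIV) {y. (x, y) \<in> S}"

definition edge_measure :: "'x measure \<Rightarrow> ('x \<times> 'x) set \<Rightarrow> ennreal" where
  "edge_measure M S = (\<integral>\<^sup>+ x. out_degree S x \<partial>M)"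

text \<open>Costs may be infinite, and \<open>cost - 1\<close> is negative for finite groups; hence \<open>ereal\<close>.\<close>

definition cost ::
    "('g, 'b) monoid_scheme \<Rightarrow> 'x measure \<Rightarrow> ('x \<Rightarrow> 'g \<Rightarrow> 'x) \<Rightarrow> ereal" where
  "cost D M act =
     enn2ereal (INF S\<in>{S. borel_subgraph M (orbit_rel D M act) S \<and> spans S (orbit_rel D M act)}.
                  edge_measure M S)"

text \<open>The affirmative answer to the multiplicativity problem. A hypothesis cannot quantify over
  types, so the carriers are sets of natural numbers and of reals. This loses no generality:
  every countable group has a copy with carrier in \<open>nat\<close>, every standard Borel space has at most
  continuum many points, and \<open>standard_borel\<close> allows an arbitrary Polish topology on an arbitrary
  set of reals, unrelated to the usual one.
  Finitely many ergodic components are required because cost is considered only for such actions.\<close>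

definition cost_minus_one_multiplicative :: bool where
  "cost_minus_one_multiplicative \<longleftrightarrow>
     (\<forall>(D :: nat monoid) (M :: real measure) (act :: real \<Rightarrow> nat \<Rightarrow> real) H.
        group D \<and> countable (carrier D) \<and> standard_borel M \<and> pmp_action D M act \<and>
        finitely_many_ergodic_components D M act \<and> essentially_free D M act \<and>
        finite_index D H \<longrightarrow>
        cost (D\<lparr>carrier := H\<rparr>) M act - 1 =
          (cost D M act - 1) * ereal (real (subgroup_index D H)))"


section \<open>Coset trees and Farber chains\<close>

text \<open>The vertices of level \<open>n\<close> are the elements of \<open>rcosets\<^bsub>G\<^esub> \<Gamma> n\<close>. A coset can occur on several
  levels, so edges and rays are indexed by the level.\<close>

definition tree_edges :: "('a, 'b) monoid_scheme \<Rightarrow> (nat \<Rightarrow> 'a set) \<Rightarrow> nat \<Rightarrow> ('a set \<times> 'a set) set" where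
  "tree_edges G \<Gamma> n = {(\<Gamma> n #>\<^bsub>G\<^esub> g, \<Gamma> (Suc n) #>\<^bsub>G\<^esub> g) | g. g \<in> carrier G}"

definition tree_boundary :: "('a, 'b) monoid_scheme \<Rightarrow> (nat \<Rightarrow> 'a set) \<Rightarrow> (nat \<Rightarrow> 'a set) set" where
  "tree_boundary G \<Gamma> = {x. \<forall>n. (x n, x (Suc n)) \<in> tree_edges G \<Gamma> n}"

definition shadow ::
    "('a, 'b) monoid_scheme \<Rightarrow> (nat \<Rightarrow> 'a set) \<Rightarrow> nat \<Rightarrow> 'a set \<Rightarrow> (nat \<Rightarrow> 'a set) set" where
  "shadow G \<Gamma> n t = {x \<in> tree_boundary G \<Gamma>. x n = t}"

definition boundary_topology ::
    "('a, 'b) monoid_scheme \<Rightarrow> (nat \<Rightarrow> 'a set) \<Rightarrow> (nat \<Rightarrow> 'a set) topology" where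
  "boundary_topology G \<Gamma> =
     topology_generated_by {shadow G \<Gamma> n t | n t. t \<in> rcosets\<^bsub>G\<^esub> (\<Gamma> n)}"

text \<open>For a chain there is exactly one such measure, since the shadows are closed under
  intersection up to the empty set and generate the Borel sets.\<close>

definition is_boundary_measure ::
    "('a, 'b) monoid_scheme \<Rightarrow> (nat \<Rightarrow> 'a set) \<Rightarrow> (nat \<Rightarrow> 'a set) measure \<Rightarrow> bool" where
  "is_boundary_measure G \<Gamma> M \<longleftrightarrow>
     prob_space M \<and> space M = tree_boundary G \<Gamma> \<and>
     sets M = sigma_sets (tree_boundary G \<Gamma>) {U. openin (boundary_topology G \<Gamma>) U} \<and>
     (\<forall>n. \<forall>t\<in>rcosets\<^bsub>G\<^esub> (\<Gamma> n).
        measure M (shadow G \<Gamma> n t) = 1 / real (subgroup_index G (\<Gamma> n)))"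

definition boundary_action ::
    "('a, 'b) monoid_scheme \<Rightarrow> (nat \<Rightarrow> 'a set) \<Rightarrow> 'a \<Rightarrow> (nat \<Rightarrow> 'a set)" where
  "boundary_action G x g = (\<lambda>n. x n #>\<^bsub>G\<^esub> g)"

definition farber_chain :: "('a, 'b) monoid_scheme \<Rightarrow> (nat \<Rightarrow> 'a set) \<Rightarrow> bool" where
  "farber_chain G \<Gamma> \<longleftrightarrow>
     is_chain G \<Gamma> \<and>
     (\<exists>M. is_boundary_measure G \<Gamma> M \<and> essentially_free G M (boundary_action G))"

end

theory Submission
  imports Defs
begin

text \<open>
  Let \<open>X\<close> be the boundary of the coset tree of a Farber chain \<open>\<Gamma>\<close> in \<open>G\<close> and let \<open>c\<close> be the cost of
  the action of \<open>G\<close> on \<open>X\<close>. The number \<open>c - 1\<close> is squeezed between the two rank gradients.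

  For a subgroup \<open>H\<close> of finite index, the edges \<open>(x, x \<cdot> s)\<close>, with \<open>s\<close> in a generating set of \<open>H\<close> of
  minimal size, span the orbit relation of \<open>H\<close>, so \<open>cost H X \<le> d H\<close>. Multiplicativity turns this into
  \<open>c - 1 \<le> (d H - 1) / |G : H|\<close>, and hence \<open>c - 1\<close> is at most the absolute rank gradient
  (\<open>cost_minus_one_le_absolute_rank_gradient\<close>).

  Conversely, let \<open>S\<close> be a spanning graph of edge measure \<open>e\<close>. By freeness an edge \<open>(x, x \<cdot> g)\<close>
  of \<open>S\<close> determines its label \<open>g\<close> for almost every \<open>x\<close>, and almost every \<open>x\<close> is joined to \<open>x \<cdot> s\<close>, for each generator \<open>s\<close>
  of \<open>G\<close>, by a path in \<open>S\<close> whose labels spell a word with value \<open>s\<close>. Up to a set of small measure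
  finitely many words suffice, hence only finitely many labels \<open>g\<close> matter, and for each of them the set
  of starting points of \<open>g\<close>-edges can be replaced by a union of shadows of some level \<open>m\<close>. Where this
  approximation destroys all the paths for \<open>s\<close>, one adds the edge labelled \<open>s\<close> itself. The result is a
  labelled graph on the finite set of cosets of \<open>\<Gamma> m\<close> with at most \<open>(e + \<epsilon>) |G : \<Gamma> m|\<close> edges, in which
  every generator of \<open>G\<close> is the value of a path from every vertex. The edges outside a spanning tree then
  generate \<open>\<Gamma> m\<close> (\<open>subgroup_generators_from_graph\<close>), so that
  \<open>(d (\<Gamma> m) - 1) / |G : \<Gamma> m| \<le> e - 1 + \<epsilon>\<close> for all large \<open>m\<close> (\<open>rank_quotient_le_edge_measure\<close>).

  Taking \<open>e\<close> close to \<open>c\<close>, the quotients of the chain are eventually at most \<open>\<epsilon>\<close> above the absolute rank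
  gradient, which is a lower bound for all of them; so they converge to it.

  The multiplicativity hypothesis concerns groups of natural numbers acting on sets of real numbers. It is
  transported along isomorphisms to the boundary action, and its premises are checked there: the boundary
  is a standard Borel space, and the action preserves the measure and is ergodic.
\<close>

section \<open>Labelled paths and generators of finite-index subgroups\<close>

text \<open>Paths traverse labelled edges in both directions: an edge from \<open>y\<close> labelled \<open>h\<close> may be used
  backwards, as a step from \<open>y \<cdot> h\<close> with label \<open>inv h\<close>.\<close>

definition labelled_step ::
    "('g, 'b) monoid_scheme \<Rightarrow> ('x \<Rightarrow> 'g \<Rightarrow> 'x) \<Rightarrow> ('x \<times> 'g) set \<Rightarrow> 'x \<Rightarrow> 'g \<Rightarrow> bool" where
  "labelled_step G act A x g \<longleftrightarrow> (x, g) \<in> A \<or> (act x g, inv\<^bsub>G\<^esub> g) \<in> A"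

fun labelled_path ::
    "('g, 'b) monoid_scheme \<Rightarrow> ('x \<Rightarrow> 'g \<Rightarrow> 'x) \<Rightarrow> ('x \<times> 'g) set \<Rightarrow> 'x \<Rightarrow> 'g list \<Rightarrow> bool" where
  "labelled_path G act A x [] \<longleftrightarrow> True"
| "labelled_path G act A x (g # w) \<longleftrightarrow>
     labelled_step G act A x g \<and> labelled_path G act A (act x g) w"

definition word_value :: "('g, 'b) monoid_scheme \<Rightarrow> 'g list \<Rightarrow> 'g" where
  "word_value G w = foldr (\<otimes>\<^bsub>G\<^esub>) w \<one>\<^bsub>G\<^esub>"

lemma word_value_Nil [simp]: "word_value G [] = \<one>\<^bsub>G\<^esub>"
  and word_value_Cons [simp]: "word_value G (g # w) = g \<otimes>\<^bsub>G\<^esub> word_value G w"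
  by (simp_all add: word_value_def)

lemma (in monoid) word_value_closed [simp]:
  "set w \<subseteq> carrier G \<Longrightarrow> word_value G w \<in> carrier G"
  by (induction w) auto

lemma (in monoid) word_value_append:
  "set v \<subseteq> carrier G \<Longrightarrow> set w \<subseteq> carrier G \<Longrightarrow>
   word_value G (v @ w) = word_value G v \<otimes> word_value G w"
  by (induction v) (auto simp: m_assoc)

lemma (in group) word_value_reverse:
  "set w \<subseteq> carrier G \<Longrightarrow> word_value G (rev (map (\<lambda>g. inv g) w)) = inv (word_value G w)"
proof (induction w)
  case (Cons g w)
  have "set (rev (map (\<lambda>g. inv g) w)) \<subseteq> carrier G" using Cons.prems by auto
  then show ?case
    using Cons by (simp add: word_value_append inv_mult_group)
qed simp

context group
begin

lemma labelled_path_mono: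
  "A \<subseteq> B \<Longrightarrow> labelled_path G act A x w \<Longrightarrow> labelled_path G act B x w"
  by (induction w arbitrary: x) (auto simp: labelled_step_def)

context
  fixes X :: "'x set" and act :: "'x \<Rightarrow> 'a \<Rightarrow> 'x"
  assumes action: "right_action G X act"
begin

lemma act_closed: "x \<in> X \<Longrightarrow> g \<in> carrier G \<Longrightarrow> act x g \<in> X"
  and act_one: "x \<in> X \<Longrightarrow> act x \<one> = x"
  and act_mult: "x \<in> X \<Longrightarrow> g \<in> carrier G \<Longrightarrow> h \<in> carrier G \<Longrightarrow> act x (g \<otimes> h) = act (act x g) h"
  using action unfolding right_action_def by blast+

lemma act_inv: "x \<in> X \<Longrightarrow> g \<in> carrier G \<Longrightarrow> act (act x g) (inv g) = x"
  "x \<in> X \<Longrightarrow> g \<in> carrier G \<Longrightarrow> act (act x (inv g)) g = x"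
  using act_mult[of x g "inv g"] act_mult[of x "inv g" g] act_one by auto

lemma labelled_path_append:
  "x \<in> X \<Longrightarrow> set v \<subseteq> carrier G \<Longrightarrow> set w \<subseteq> carrier G \<Longrightarrow>
   labelled_path G act A x (v @ w) \<longleftrightarrow>
   labelled_path G act A x v \<and> labelled_path G act A (act x (word_value G v)) w"
  by (induction v arbitrary: x) (auto simp: act_one act_mult act_closed)

lemma labelled_step_reverse:
  "x \<in> X \<Longrightarrow> g \<in> carrier G \<Longrightarrow> labelled_step G act A x g \<Longrightarrow>
   labelled_step G act A (act x g) (inv g)"
  by (auto simp: labelled_step_def act_inv)

lemma labelled_path_reverse:
  "x \<in> X \<Longrightarrow> set w \<subseteq> carrier G \<Longrightarrow> labelled_path G act A x w \<Longrightarrow>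
   labelled_path G act A (act x (word_value G w)) (rev (map (\<lambda>g. inv g) w))"
proof (induction w arbitrary: x)
  case (Cons g w)
  let ?v = "rev (map (\<lambda>g. inv g) w)" and ?y = "act (act x g) (word_value G w)"
  have w: "set w \<subseteq> carrier G" and g: "g \<in> carrier G" and v: "set ?v \<subseteq> carrier G"
    using Cons.prems by auto
  have xg: "act x g \<in> X" and y: "?y \<in> X" using Cons.prems g w by (auto simp: act_closed)
  have "act ?y (word_value G ?v) = act x g"
    using xg w by (simp add: word_value_reverse act_inv)
  then have "labelled_path G act A ?y (?v @ [inv g])"
    using labelled_path_append[OF y v, of "[inv g]" A] Cons g w xg
    by (simp add: labelled_step_reverse)
  then show ?case using Cons.prems g w by (simp add: act_mult)
qed simp

text \<open>This produces the next edge when a tree is grown towards a vertex that it does not yet contain.\<close>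

lemma labelled_path_leaves:
  "x \<in> X \<Longrightarrow> set w \<subseteq> carrier G \<Longrightarrow> labelled_path G act A x w \<Longrightarrow>
   x \<in> U \<Longrightarrow> act x (word_value G w) \<notin> U \<Longrightarrow>
   \<exists>u\<in>U. \<exists>g\<in>carrier G. u \<in> X \<and> labelled_step G act A u g \<and> act u g \<notin> U"
proof (induction w arbitrary: x)
  case Nil then show ?case by (simp add: act_one)
next
  case (Cons g w)
  show ?case
  proof (cases "act x g \<in> U")
    case True
    then show ?thesis using Cons.IH[of "act x g"] Cons.prems by (simp add: act_closed act_mult)
  next
    case False
    then show ?thesis using Cons.prems by auto
  qed
qed

text \<open>The elements that are values of paths from every point form a subgroup: concatenate paths for a product
  and reverse a path for an inverse.\<close>

lemma labelled_paths_generate: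
  assumes S: "S \<subseteq> carrier G"
    and paths: "\<And>x s. x \<in> X \<Longrightarrow> s \<in> S \<Longrightarrow>
      \<exists>w. set w \<subseteq> carrier G \<and> labelled_path G act A x w \<and> word_value G w = s"
    and "g \<in> generate G S" "x \<in> X"
  shows "\<exists>w. set w \<subseteq> carrier G \<and> labelled_path G act A x w \<and> word_value G w = g"
  using assms(3,4)
proof (induction g arbitrary: x rule: generate.induct)
  case one
  then show ?case by (intro exI[of _ "[]"]) simp
next
  case (incl h)
  then show ?case by (intro paths)
next
  case (inv h)
  then have h: "h \<in> carrier G" using S by blast
  obtain w where w: "set w \<subseteq> carrier G" "labelled_path G act A (act x (inv h)) w"
      "word_value G w = h"
    using paths[of "act x (inv h)" h] inv h by (auto simp: act_closed)
  have "labelled_path G act A x (rev (map (\<lambda>g. inv g) w))"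
    using labelled_path_reverse[OF _ w(1,2)] w(3) h inv by (simp add: act_closed act_inv)
  moreover have "set (rev (map (\<lambda>g. inv g) w)) \<subseteq> carrier G" using w(1) by auto
  ultimately show ?case using w by (metis word_value_reverse)
next
  case (eng h1 h2)
  have h: "h1 \<in> carrier G" "h2 \<in> carrier G"
    using eng.hyps generate_in_carrier[OF S] by auto
  obtain v where v: "set v \<subseteq> carrier G" "labelled_path G act A x v" "word_value G v = h1"
    using eng by blast
  obtain w where w: "set w \<subseteq> carrier G" "labelled_path G act A (act x h1) w" "word_value G w = h2"
    using eng.IH(2)[of "act x h1"] eng.prems h by (auto simp: act_closed)
  show ?case
    using v w eng.prems
    by (intro exI[of _ "v @ w"]) (simp add: labelled_path_append word_value_append)
qed

end

lemma rcosets_action: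
  assumes "subgroup K G"
  shows "right_action G (rcosets K) (\<lambda>t g. t #> g)"
  unfolding right_action_def
proof (intro conjI ballI)
  have K: "K \<subseteq> carrier G" using assms by (rule subgroup.subset)
  fix t assume "t \<in> rcosets K"
  then obtain a where a: "a \<in> carrier G" "t = K #> a" by (auto simp: RCOSETS_def)
  show "t #> \<one> = t" using a K by (simp add: coset_mult_assoc)
  fix g assume g: "g \<in> carrier G"
  show "t #> g \<in> rcosets K" using a g K by (auto simp: coset_mult_assoc intro: rcosetsI)
  fix h assume h: "h \<in> carrier G"
  show "t #> (g \<otimes> h) = t #> g #> h" using a g h K by (simp add: coset_mult_assoc m_assoc)
qed

lemma coset_eq_iff:
  assumes "subgroup K G" "a \<in> carrier G" "b \<in> carrier G"
  shows "K #> a = K #> b \<longleftrightarrow> a \<otimes> inv b \<in> K"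
proof
  have K: "K \<subseteq> carrier G" using assms(1) by (rule subgroup.subset)
  show "a \<otimes> inv b \<in> K" if "K #> a = K #> b"
    using coset_mult_inv2[OF that assms(2,3) K] coset_join1[OF _ _ assms(1)] assms by simp
  show "K #> a = K #> b" if "a \<otimes> inv b \<in> K"
    using coset_join2[OF _ assms(1) that] coset_mult_inv1[OF _ assms(2,3) K] assms by simp
qed

text \<open>A tree with vertex set \<open>U\<close> containing the root \<open>K\<close>, grown edge by edge. Being a tree is
  expressed by the numbers of vertices and edges. The coset representatives \<open>s\<close> are chosen along the
  tree, so that \<open>s t\<close> is the product of the labels on the way from the root to \<open>t\<close>, with the label
  of an edge traversed backwards inverted.\<close>

definition partial_tree ::
    "'a set \<Rightarrow> ('a set \<times> 'a) set \<Rightarrow> 'a set set \<Rightarrow> ('a set \<times> 'a) set \<Rightarrow> ('a set \<Rightarrow> 'a) \<Rightarrow> bool" where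
  "partial_tree K E U T s \<longleftrightarrow>
     U \<subseteq> rcosets K \<and> K \<in> U \<and> T \<subseteq> E \<and> card U = Suc (card T) \<and> s K = \<one> \<and>
     (\<forall>u\<in>U. s u \<in> carrier G \<and> K #> s u = u) \<and>
     (\<forall>(t, g)\<in>T. t \<in> U \<and> t #> g \<in> U \<and> s t \<otimes> g = s (t #> g))"

text \<open>The new vertex receives its representative from the edge that reaches it, whichever way that edge
  points.\<close>

lemma partial_tree_extend:
  assumes K: "subgroup K G" and fin: "finite (rcosets K)" and E: "finite E" "E \<subseteq> (rcosets K) \<times> carrier G"
    and tree: "partial_tree K E U T s"
    and u: "u \<in> U" and g: "g \<in> carrier G" and step: "labelled_step G (\<lambda>t g. t #> g) E u g"
    and v: "u #> g \<notin> U"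
  shows "\<exists>T' s'. partial_tree K E (insert (u #> g) U) T' s'"
proof -
  note action = rcosets_action[OF K]
  have U: "U \<subseteq> rcosets K" "K \<in> U" "T \<subseteq> E" "card U = Suc (card T)" "s K = \<one>"
    and s: "\<And>u. u \<in> U \<Longrightarrow> s u \<in> carrier G \<and> K #> s u = u"
    and T: "\<And>t g. (t, g) \<in> T \<Longrightarrow> t \<in> U \<and> t #> g \<in> U \<and> s t \<otimes> g = s (t #> g)"
    using tree unfolding partial_tree_def by auto
  have Kc: "K \<subseteq> carrier G" using K by (rule subgroup.subset)
  let ?v = "u #> g"
  have vV: "?v \<in> rcosets K" using act_closed[OF action] U(1) u g by blast
  let ?s = "s(?v := s u \<otimes> g)"
  have sv: "s u \<otimes> g \<in> carrier G" "K #> (s u \<otimes> g) = ?v"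
    using s[OF u] g Kc by (auto simp flip: coset_mult_assoc)
  have finT: "finite T" using U(3) E(1) finite_subset by blast
  have finU: "finite U" using U(1) fin finite_subset by blast
  have return: "?v #> inv g = u" using act_inv(1)[OF action] U(1) u g by blast
  obtain e where e: "e \<in> E" "e \<notin> T"
    "case e of (t, h) \<Rightarrow> t \<in> insert ?v U \<and> t #> h \<in> insert ?v U \<and> ?s t \<otimes> h = ?s (t #> h)"
  proof (cases "(u, g) \<in> E")
    case True
    moreover have "(u, g) \<notin> T" using T v by blast
    moreover have "u \<noteq> ?v" using u v by metis
    ultimately show ?thesis using that[of "(u, g)"] u v by auto
  next
    case False
    then have "(?v, inv g) \<in> E" using step unfolding labelled_step_def by blast
    moreover have "(?v, inv g) \<notin> T" using T v by blast
    moreover have "u \<noteq> ?v" using u v by metis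
    moreover have "s u \<otimes> g \<otimes> inv g = s u" using s[OF u] g by (simp add: m_assoc)
    ultimately show ?thesis using that[of "(?v, inv g)"] u v return by auto
  qed
  have "t \<in> insert ?v U \<and> t #> h \<in> insert ?v U \<and> ?s t \<otimes> h = ?s (t #> h)" if th: "(t, h) \<in> insert e T" for t h
  proof -
    consider "e = (t, h)" | "(t, h) \<in> T" using th by blast
    then show ?thesis
    proof cases
      case 1
      show ?thesis using e(3) unfolding 1 by blast
    next
      case 2
      then have "t \<noteq> ?v" "t #> h \<noteq> ?v" using T[OF 2] v by metis+
      then show ?thesis using T[OF 2] by simp
    qed
  qed
  then have edges: "\<forall>(t, h)\<in>insert e T.
      t \<in> insert ?v U \<and> t #> h \<in> insert ?v U \<and> ?s t \<otimes> h = ?s (t #> h)"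
    by (intro ballI) (auto simp del: fun_upd_apply insert_iff)
  have card: "card (insert ?v U) = Suc (card (insert e T))"
    using U(4) finT finU v e(2) by simp
  have root: "?s K = \<one>" using U(2,5) v by auto
  have reps: "\<forall>t\<in>insert ?v U. ?s t \<in> carrier G \<and> K #> ?s t = t"
  proof
    fix t assume t: "t \<in> insert ?v U"
    show "?s t \<in> carrier G \<and> K #> ?s t = t"
    proof (cases "t = ?v")
      case True
      show ?thesis unfolding True fun_upd_same using sv by blast
    next
      case False
      then have "t \<in> U" using t by blast
      then show ?thesis unfolding fun_upd_other[OF False] by (rule s)
    qed
  qed
  have "insert ?v U \<subseteq> rcosets K" "K \<in> insert ?v U" "insert e T \<subseteq> E"
    using U(1-3) vV e(1) by auto
  then have "partial_tree K E (insert ?v U) (insert e T) ?s"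
    unfolding partial_tree_def by (intro conjI card root reps edges)
  then show ?thesis by blast
qed

lemma spanning_tree_exists:
  assumes K: "subgroup K G" and fin: "finite (rcosets K)" and E: "finite E" "E \<subseteq> (rcosets K) \<times> carrier G"
    and conn: "\<And>g. g \<in> carrier G \<Longrightarrow>
      \<exists>w. set w \<subseteq> carrier G \<and> labelled_path G (\<lambda>t g. t #> g) E K w \<and> word_value G w = g"
  shows "\<exists>T s. partial_tree K E (rcosets K) T s"
proof -
  note action = rcosets_action[OF K]
  have Kc: "K \<subseteq> carrier G" using K by (rule subgroup.subset)
  have KV: "K \<in> rcosets K" using rcosetsI[OF Kc one_closed] Kc by simp
  \<comment> \<open>As long as the tree misses a coset, it can be extended.\<close>
  have "\<exists>U T s. partial_tree K E U T s \<and> card U = Suc k" if "k < card (rcosets K)" for k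
    using that
  proof (induction k)
    case 0
    have "partial_tree K E {K} {} (\<lambda>_. \<one>)" unfolding partial_tree_def using KV Kc by auto
    then show ?case by (intro exI[of _ "{K}"]) auto
  next
    case (Suc k)
    then obtain U T s where tree: "partial_tree K E U T s" and card: "card U = Suc k" by auto
    have U: "U \<subseteq> rcosets K" "K \<in> U" using tree unfolding partial_tree_def by auto
    have finU: "finite U" using U(1) fin finite_subset by blast
    obtain v where v: "v \<in> rcosets K" "v \<notin> U"
      using U(1) Suc.prems card by (cases "rcosets K \<subseteq> U") auto
    then obtain g where g: "g \<in> carrier G" "v = K #> g" by (auto simp: RCOSETS_def)
    obtain w where "set w \<subseteq> carrier G" "labelled_path G (\<lambda>t g. t #> g) E K w" "word_value G w = g"
      using conn[OF g(1)] by blast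
    then obtain u h where uh: "u \<in> U" "h \<in> carrier G" "labelled_step G (\<lambda>t g. t #> g) E u h" "u #> h \<notin> U"
      using labelled_path_leaves[OF action KV, of w E U] U(2) v(2) g(2) by blast
    obtain T' s' where "partial_tree K E (insert (u #> h) U) T' s'"
      using partial_tree_extend[OF K fin E tree uh] by blast
    moreover have "card (insert (u #> h) U) = Suc (Suc k)" using card finU uh(4) by simp
    ultimately show ?case by blast
  qed
  moreover have pos: "card (rcosets K) > 0" using KV fin card_gt_0_iff by blast
  ultimately have "\<exists>U T s. partial_tree K E U T s \<and> card U = Suc (card (rcosets K) - 1)"
    by (metis diff_less zero_less_one)
  then obtain U T s where tree: "partial_tree K E U T s" and "card U = card (rcosets K)"
    using pos by auto
  moreover have "U \<subseteq> rcosets K" using tree unfolding partial_tree_def by blast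
  ultimately show ?thesis using fin card_subset_eq by metis
qed

text \<open>Schreier's argument, for labelled graphs. An edge \<open>(t, g)\<close> gives the element
  \<open>s t \<otimes> g \<otimes> inv (s (t #> g))\<close> of \<open>K\<close>, which is trivial for tree edges. Along a closed path at the root
  these elements multiply to the value of the path because consecutive representatives cancel. Since every
  element of \<open>K\<close> is the value of such a path, the non-tree edges generate \<open>K\<close>.\<close>

lemma subgroup_generators_from_graph:
  assumes K: "subgroup K G" and fin: "finite (rcosets K)"
    and E: "finite E" "E \<subseteq> (rcosets K) \<times> carrier G"
    and S: "S \<subseteq> carrier G" "generate G S = carrier G"
    and paths: "\<And>t s. t \<in> rcosets K \<Longrightarrow> s \<in> S \<Longrightarrow>
      \<exists>w. set w \<subseteq> carrier G \<and> labelled_path G (\<lambda>t g. t #> g) E t w \<and> word_value G w = s"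
  shows "\<exists>Y. finite Y \<and> Y \<subseteq> K \<and> generate G Y = K \<and> card Y + card (rcosets K) \<le> card E + 1"
proof -
  note action = rcosets_action[OF K]
  have Kc: "K \<subseteq> carrier G" using K by (rule subgroup.subset)
  have KV: "K \<in> rcosets K" using rcosetsI[OF Kc one_closed] Kc by simp
  have conn: "\<exists>w. set w \<subseteq> carrier G \<and> labelled_path G (\<lambda>t g. t #> g) E K w \<and> word_value G w = g"
    if "g \<in> carrier G" for g
    using labelled_paths_generate[OF action S(1) paths _ KV, of g] S(2) that by auto
  obtain T s where tree: "partial_tree K E (rcosets K) T s"
    using spanning_tree_exists[OF K fin E conn] by blast
  have TE: "T \<subseteq> E" and cardT: "card (rcosets K) = Suc (card T)" and sK: "s K = \<one>"
    and s: "\<And>t. t \<in> rcosets K \<Longrightarrow> s t \<in> carrier G" "\<And>t. t \<in> rcosets K \<Longrightarrow> K #> s t = t"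
    and T: "\<And>t g. (t, g) \<in> T \<Longrightarrow> s t \<otimes> g = s (t #> g)"
    using tree unfolding partial_tree_def by auto
  define c where "c = (\<lambda>(t, g). s t \<otimes> g \<otimes> inv (s (t #> g)))"
  define Y where "Y = c ` (E - T)"
  have closed: "t #> g \<in> rcosets K" if "t \<in> rcosets K" "g \<in> carrier G" for t g
    using act_closed[OF action that] .
  have YK: "Y \<subseteq> K"
  proof
    fix y assume "y \<in> Y"
    then obtain t g where tg: "t \<in> rcosets K" "g \<in> carrier G" "y = s t \<otimes> g \<otimes> inv (s (t #> g))"
      unfolding Y_def c_def using E(2) by auto
    have "K #> (s t \<otimes> g) = K #> s (t #> g)"
      using tg s closed Kc by (simp flip: coset_mult_assoc)
    then show "y \<in> K"
      using coset_eq_iff[OF K, of "s t \<otimes> g" "s (t #> g)"] tg s closed by simp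
  qed
  then have Yc: "Y \<subseteq> carrier G" using Kc by blast
  have edge: "c (t, g) \<in> generate G Y" if "(t, g) \<in> E" for t g
  proof (cases "(t, g) \<in> T")
    case True
    then have "c (t, g) = \<one>" using T E(2) that s closed unfolding c_def by auto
    then show ?thesis by (simp add: generate.one)
  next
    case False
    then show ?thesis using that unfolding Y_def by (intro generate.incl) auto
  qed
  have step: "c (t, g) \<in> generate G Y"
    if "t \<in> rcosets K" "g \<in> carrier G" "labelled_step G (\<lambda>t g. t #> g) E t g" for t g
  proof (cases "(t, g) \<in> E")
    case False
    then have "c (t #> g, inv g) \<in> generate G Y"
      using that(3) edge unfolding labelled_step_def by blast
    then have "inv (c (t #> g, inv g)) \<in> generate G Y"
      using generate_m_inv_closed[OF Yc] by blast
    moreover have "inv (c (t #> g, inv g)) = c (t, g)"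
      unfolding c_def using that s closed act_inv(1)[OF action] by (simp add: inv_mult_group m_assoc)
    ultimately show ?thesis by simp
  qed (use edge in blast)
  have path: "c (t, word_value G w) \<in> generate G Y"
    if "t \<in> rcosets K" "set w \<subseteq> carrier G" "labelled_path G (\<lambda>t g. t #> g) E t w" for t w
    using that
  proof (induction w arbitrary: t)
    case Nil
    then show ?case unfolding c_def using s act_one[OF action] by (simp add: generate.one)
  next
    case (Cons g w)
    let ?h = "word_value G w"
    have g: "g \<in> carrier G" and h: "?h \<in> carrier G" using Cons.prems by auto
    have "c (t, g) \<otimes> c (t #> g, ?h) \<in> generate G Y"
      using Cons g closed step by (intro generate.eng) auto
    moreover have "c (t, g) \<otimes> c (t #> g, ?h) = c (t, g \<otimes> ?h)"
    proof -
      \<comment> \<open>The representatives of the intermediate coset cancel.\<close>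
      have "inv (s (t #> g)) \<otimes> (s (t #> g) \<otimes> (?h \<otimes> z)) = ?h \<otimes> z" if "z \<in> carrier G" for z
        using s closed Cons.prems g h that by (simp flip: m_assoc)
      then show ?thesis
        unfolding c_def using s closed Cons.prems g h act_mult[OF action]
        by (simp add: m_assoc)
    qed
    ultimately show ?case by simp
  qed
  have "K \<subseteq> generate G Y"
  proof
    fix k assume k: "k \<in> K"
    then have kc: "k \<in> carrier G" using Kc by blast
    obtain w where w: "set w \<subseteq> carrier G" "labelled_path G (\<lambda>t g. t #> g) E K w" "word_value G w = k"
      using conn[OF kc] by blast
    have "K #> k = K" using coset_join2[OF kc K k] .
    then have "c (K, k) = k" unfolding c_def using sK kc by simp
    then show "k \<in> generate G Y" using path[OF KV w(1,2)] w(3) by simp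
  qed
  then have "generate G Y = K" using generate_subgroup_incl[OF YK K] by blast
  moreover have "finite Y" unfolding Y_def using E(1) by blast
  moreover have "card Y + card (rcosets K) \<le> card E + 1"
  proof -
    have "card Y \<le> card (E - T)" unfolding Y_def using E(1) by (intro card_image_le) auto
    also have "\<dots> = card E - card T" using TE E(1) by (intro card_Diff_subset) (auto intro: finite_subset)
    finally show ?thesis using cardT card_mono[OF E(1) TE] by linarith
  qed
  ultimately show ?thesis using YK by blast
qed

lemma min_generators_subgroup:
  assumes "subgroup K G"
  shows "min_generators (G\<lparr>carrier := K\<rparr>) =
    (LEAST k. \<exists>Y. finite Y \<and> Y \<subseteq> K \<and> generate G Y = K \<and> card Y = k)"
proof -
  have *: "generate (G\<lparr>carrier := K\<rparr>) Y = generate G Y" if "Y \<subseteq> K" for Y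
    by (rule generate_consistent[OF that assms])
  have carr: "carrier (G\<lparr>carrier := K\<rparr>) = K" by simp
  have "(finite Y \<and> Y \<subseteq> K \<and> generate (G\<lparr>carrier := K\<rparr>) Y = K \<and> card Y = k) \<longleftrightarrow>
        (finite Y \<and> Y \<subseteq> K \<and> generate G Y = K \<and> card Y = k)" for Y k
    by (cases "Y \<subseteq> K") (simp_all only: * simp_thms)
  then show ?thesis unfolding min_generators_def carr by (simp only:)
qed

lemma min_generators_le:
  assumes "subgroup K G" "finite Y" "Y \<subseteq> K" "generate G Y = K"
  shows "min_generators (G\<lparr>carrier := K\<rparr>) \<le> card Y"
  unfolding min_generators_subgroup[OF assms(1)] using assms(2-4) by (intro Least_le) blast

lemma min_generators_attained:
  assumes "subgroup K G" "finite Y" "Y \<subseteq> K" "generate G Y = K"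
  shows "\<exists>Z. finite Z \<and> Z \<subseteq> K \<and> generate G Z = K \<and> card Z = min_generators (G\<lparr>carrier := K\<rparr>)"
  unfolding min_generators_subgroup[OF assms(1)]
  by (rule LeastI[where k = "card Y"]) (use assms(2-4) in blast)

text \<open>Applied to the Schreier graph itself, in which every coset has one edge for each generator.\<close>

lemma finite_index_imp_finitely_generated:
  assumes "finitely_generated G" "finite_index G K"
  shows "\<exists>Y. finite Y \<and> Y \<subseteq> K \<and> generate G Y = K"
proof -
  have K: "subgroup K G" and fin: "finite (rcosets K)" using assms(2) unfolding finite_index_def by auto
  obtain S where S: "finite S" "S \<subseteq> carrier G" "generate G S = carrier G"
    using assms(1) unfolding finitely_generated_def by blast
  have "\<exists>w. set w \<subseteq> carrier G \<and> labelled_path G (\<lambda>t g. t #> g) ((rcosets K) \<times> S) t w \<and> word_value G w = s"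
    if "t \<in> rcosets K" "s \<in> S" for t s
    using that S(2) by (intro exI[of _ "[s]"]) (auto simp: labelled_step_def)
  moreover have "finite ((rcosets K) \<times> S)" "(rcosets K) \<times> S \<subseteq> (rcosets K) \<times> carrier G"
    using fin S by auto
  ultimately show ?thesis
    using subgroup_generators_from_graph[OF K fin _ _ S(2,3), of "(rcosets K) \<times> S"] by meson
qed

lemma finitely_generated_imp_countable:
  assumes "finitely_generated G"
  shows "countable (carrier G)"
proof -
  obtain S where S: "finite S" "S \<subseteq> carrier G" "generate G S = carrier G"
    using assms unfolding finitely_generated_def by blast
  let ?L = "S \<union> (\<lambda>s. inv s) ` S"
  have L: "?L \<subseteq> carrier G" using S by auto
  have "g \<in> word_value G ` lists ?L" if "g \<in> generate G S" for g
    using that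
  proof (induction rule: generate.induct)
    case one then show ?case by (intro image_eqI[of _ _ "[]"]) auto
  next
    case (incl h) then show ?case using S(2) by (intro image_eqI[of _ _ "[h]"]) auto
  next
    case (inv h) then show ?case using S(2) by (intro image_eqI[of _ _ "[inv h]"]) auto
  next
    case (eng g h)
    then obtain v w where vw: "v \<in> lists ?L" "w \<in> lists ?L"
        and g: "g = word_value G v" and h: "h = word_value G w" by blast
    then have "set v \<subseteq> carrier G" "set w \<subseteq> carrier G" using L by (auto simp: in_lists_conv_set)
    then have "g \<otimes> h = word_value G (v @ w)" unfolding g h by (simp add: word_value_append)
    then show ?case using vw by (intro image_eqI[of _ _ "v @ w"]) auto
  qed
  then have "carrier G \<subseteq> word_value G ` lists ?L" unfolding S(3) by (rule subsetI)
  moreover have "countable (lists ?L)" using S(1) by (intro countable_lists countable_finite) simp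
  ultimately show ?thesis using countable_subset[OF _ countable_image] by metis
qed

end

section \<open>Transport of costs along isomorphisms\<close>

text \<open>Out-degrees will be integrated without using that they are measurable, so \<open>u\<close> is arbitrary.
  Its integral is a supremum over simple functions below it, and these correspond under an
  isomorphism.\<close>

lemma nn_integral_comp_le:
  assumes f: "f \<in> M \<rightarrow>\<^sub>M N" and h: "h \<in> N \<rightarrow>\<^sub>M M" and hf: "\<And>x. x \<in> space M \<Longrightarrow> h (f x) = x"
    and fh: "\<And>y. y \<in> space N \<Longrightarrow> f (h y) = y" and distr: "distr M N f = N"
  shows "(\<integral>\<^sup>+x. u (f x) \<partial>M) \<le> (\<integral>\<^sup>+y. u y \<partial>N)"
  unfolding nn_integral_def[of M]
proof (rule SUP_least)
  fix g assume "g \<in> {g. simple_function M g \<and> g \<le> (\<lambda>x. u (f x))}"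
  then have g: "simple_function M g" and le: "\<And>x. g x \<le> u (f x)" by (auto simp: le_fun_def)
  have gm: "g \<in> borel_measurable M" using g by (rule borel_measurable_simple_function)
  have "integral\<^sup>S M g = (\<integral>\<^sup>+x. g x \<partial>M)" using nn_integral_eq_simple_integral[OF g] by simp
  also have "\<dots> = (\<integral>\<^sup>+x. g (h (f x)) \<partial>M)" using hf by (intro nn_integral_cong) simp
  also have "\<dots> = (\<integral>\<^sup>+y. g (h y) \<partial>distr M N f)"
    using f h gm by (intro nn_integral_distr[symmetric]) auto
  also have "\<dots> = (\<integral>\<^sup>+y. g (h y) \<partial>N)" by (simp only: distr)
  also have "\<dots> \<le> (\<integral>\<^sup>+y. u y \<partial>N)" using le fh by (intro nn_integral_mono) metis
  finally show "integral\<^sup>S M g \<le> (\<integral>\<^sup>+y. u y \<partial>N)" .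
qed

lemma emeasure_count_space_image:
  assumes "inj_on f A"
  shows "emeasure (count_space UNIV) (f ` A) = emeasure (count_space UNIV) A"
  using assms by (cases "finite A") (simp_all add: card_image finite_image_iff)

text \<open>Spanning graphs are pulled back along \<open>f\<close>. Only the orbit relations are compared, so that the two
  groups may differ.\<close>

lemma cost_le_of_isomorphism:
  fixes D :: "('g, 'b) monoid_scheme" and D' :: "('k, 'c) monoid_scheme"
  assumes f: "f \<in> M \<rightarrow>\<^sub>M N" and h: "h \<in> N \<rightarrow>\<^sub>M M" and hf: "\<And>x. x \<in> space M \<Longrightarrow> h (f x) = x"
    and fh: "\<And>y. y \<in> space N \<Longrightarrow> f (h y) = y" and distr: "distr M N f = N"
    and orbits: "\<And>x y. x \<in> space M \<Longrightarrow> y \<in> space M \<Longrightarrow>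
      (f x, f y) \<in> orbit_rel D' N act' \<longleftrightarrow> (x, y) \<in> orbit_rel D M act"
  shows "cost D M act \<le> cost D' N act'"
proof -
  have fs: "f x \<in> space N" if "x \<in> space M" for x using measurable_space[OF f that] .
  have hs: "h y \<in> space M" if "y \<in> space N" for y using measurable_space[OF h that] .
  have sub: "orbit_rel D' N act' \<subseteq> space N \<times> space N" unfolding orbit_rel_def by auto
  have "(INF S\<in>{S. borel_subgraph M (orbit_rel D M act) S \<and> spans S (orbit_rel D M act)}. edge_measure M S)
      \<le> edge_measure N S'"
    if S': "borel_subgraph N (orbit_rel D' N act') S'" "spans S' (orbit_rel D' N act')" for S'
  proof -
    define S where "S = {(x, y). x \<in> space M \<and> y \<in> space M \<and> (f x, f y) \<in> S'}"
    have S'_sub: "S' \<subseteq> orbit_rel D' N act'" "S' \<in> sets (N \<Otimes>\<^sub>M N)"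
      using S'(1) unfolding borel_subgraph_def by (rule conjunct1, rule conjunct2)
    have "S = (\<lambda>p. (f (fst p), f (snd p))) -` S' \<inter> space (M \<Otimes>\<^sub>M M)"
      unfolding S_def space_pair_measure by auto
    moreover have "(\<lambda>p. (f (fst p), f (snd p))) \<in> M \<Otimes>\<^sub>M M \<rightarrow>\<^sub>M N \<Otimes>\<^sub>M N"
      by (intro measurable_Pair measurable_compose[OF measurable_fst f] measurable_compose[OF measurable_snd f])
    ultimately have "S \<in> sets (M \<Otimes>\<^sub>M M)" using measurable_sets S'_sub(2) by simp
    moreover have "S \<subseteq> orbit_rel D M act"
    proof (rule subrelI)
      fix x y assume "(x, y) \<in> S"
      then show "(x, y) \<in> orbit_rel D M act"
        using orbits[of x y] subsetD[OF S'_sub(1), of "(f x, f y)"] unfolding S_def by simp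
    qed
    ultimately have 1: "borel_subgraph M (orbit_rel D M act) S" unfolding borel_subgraph_def by simp
    have path: "(x, h z) \<in> (S \<union> S\<inverse>)\<^sup>*" if x: "x \<in> space M" and "(f x, z) \<in> (S' \<union> S'\<inverse>)\<^sup>*" for x z
      using that(2)
    proof (induction rule: rtrancl_induct)
      case base then show ?case using hf x by simp
    next
      case (step y z)
      have yz: "y \<in> space N" "z \<in> space N" using step.hyps(2) S'_sub(1) sub by blast+
      then have "(h y, h z) \<in> S \<union> S\<inverse>"
        using step.hyps(2) hs[OF yz(1)] hs[OF yz(2)] fh[OF yz(1)] fh[OF yz(2)] unfolding S_def by simp
      then show ?case using step.IH by (rule rtrancl_into_rtrancl[rotated])
    qed
    have 2: "spans S (orbit_rel D M act)"
      unfolding spans_def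
    proof (clarify)
      fix x y assume xy: "(x, y) \<in> orbit_rel D M act" "x \<noteq> y"
      then have sp: "x \<in> space M" "y \<in> space M" unfolding orbit_rel_def by auto
      have "f x \<noteq> f y" using hf[OF sp(1)] hf[OF sp(2)] xy(2) by metis
      then have "(f x, f y) \<in> (S' \<union> S'\<inverse>)\<^sup>*"
        using bspec[OF S'(2)[unfolded spans_def], of "(f x, f y)"] orbits[OF sp] xy(1) by simp
      then show "(x, y) \<in> (S \<union> S\<inverse>)\<^sup>*" using path[OF sp(1), of "f y"] hf[OF sp(2)] by simp
    qed
    have "out_degree S x = out_degree S' (f x)" if x: "x \<in> space M" for x
    proof -
      have "{z. (f x, z) \<in> S'} = f ` {y. (x, y) \<in> S}"
      proof (intro equalityI subsetI)
        fix z assume z: "z \<in> {z. (f x, z) \<in> S'}"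
        then have "z \<in> space N" using S'_sub(1) sub by blast
        then show "z \<in> f ` {y. (x, y) \<in> S}"
          using z x hs fh unfolding S_def by (intro image_eqI[of _ _ "h z"]) auto
      qed (auto simp: S_def)
      moreover have "inj_on f {y. (x, y) \<in> S}" unfolding S_def by (rule inj_on_inverseI[of _ h]) (auto simp: hf)
      ultimately show ?thesis unfolding out_degree_def by (simp add: emeasure_count_space_image)
    qed
    then have "edge_measure M S = (\<integral>\<^sup>+x. out_degree S' (f x) \<partial>M)"
      unfolding edge_measure_def by (intro nn_integral_cong)
    also have "\<dots> \<le> edge_measure N S'"
      unfolding edge_measure_def by (rule nn_integral_comp_le[OF f h hf fh distr])
    finally show ?thesis using 1 2 by (intro INF_lower2[of S]) simp_all
  qed
  then have "(INF S\<in>{S. borel_subgraph M (orbit_rel D M act) S \<and> spans S (orbit_rel D M act)}. edge_measure M S)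
      \<le> (INF S\<in>{S. borel_subgraph N (orbit_rel D' N act') S \<and> spans S (orbit_rel D' N act')}. edge_measure N S)"
    by (intro INF_greatest) blast
  then show ?thesis unfolding cost_def less_eq_ennreal.rep_eq .
qed

lemma cost_eq_of_isomorphism:
  fixes D :: "('g, 'b) monoid_scheme" and D' :: "('k, 'c) monoid_scheme"
  assumes f: "f \<in> M \<rightarrow>\<^sub>M N" and h: "h \<in> N \<rightarrow>\<^sub>M M" and hf: "\<And>x. x \<in> space M \<Longrightarrow> h (f x) = x"
    and fh: "\<And>y. y \<in> space N \<Longrightarrow> f (h y) = y" and distr: "distr M N f = N"
    and orbits: "\<And>x y. x \<in> space M \<Longrightarrow> y \<in> space M \<Longrightarrow>
      (f x, f y) \<in> orbit_rel D' N act' \<longleftrightarrow> (x, y) \<in> orbit_rel D M act"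
  shows "cost D M act = cost D' N act'"
proof (rule antisym)
  show "cost D M act \<le> cost D' N act'" by (rule cost_le_of_isomorphism[OF assms])
  have "distr N M h = distr (distr M N f) M h" by (simp only: distr)
  also have "\<dots> = distr M M (h \<circ> f)" by (rule distr_distr[OF h f])
  also have "\<dots> = distr M M (\<lambda>x. x)" using hf by (intro distr_cong) auto
  finally have distr': "distr N M h = M" by (simp add: distr_id)
  show "cost D' N act' \<le> cost D M act"
  proof (rule cost_le_of_isomorphism[OF h f fh hf distr'])
    fix x y assume xy: "x \<in> space N" "y \<in> space N"
    then show "(h x, h y) \<in> orbit_rel D M act \<longleftrightarrow> (x, y) \<in> orbit_rel D' N act'"
      using orbits[of "h x" "h y"] measurable_space[OF h] by (simp add: fh)
  qed
qed

text \<open>The topology is carried over with the points, so \<open>f\<close> is a homeomorphism onto its image whatever its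
  relation to the usual topology of the target.\<close>

lemma standard_borel_embed_measure:
  assumes M: "standard_borel M" and inj: "inj_on f (space M)"
  shows "standard_borel (embed_measure M f)"
proof -
  obtain T where T: "completely_metrizable_space T" "second_countable T" "topspace T = space M"
      "sets M = sigma_sets (topspace T) {U. openin T U}"
    using M unfolding standard_borel_def by blast
  let ?X = "f ` space M" and ?k = "the_inv_into (space M) f"
  let ?P = "pullback_topology ?X ?k T"
  have k: "?k (f x) = x" if "x \<in> space M" for x using the_inv_into_f_f[OF inj that] .
  have top: "topspace ?P = ?X" unfolding topspace_pullback_topology T(3) using k by auto
  have "continuous_map ?P T (id \<circ> ?k)" by (intro continuous_map_pullback continuous_map_id)
  moreover have "continuous_map T ?P f"
  proof (rule continuous_map_pullback')
    show "continuous_map T T (?k \<circ> f)"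
      by (rule continuous_map_eq[OF continuous_map_id]) (simp add: k T(3))
  qed (auto simp: T(3))
  ultimately have "homeomorphic_maps T ?P f ?k"
    unfolding homeomorphic_maps_def top T(3) using k by auto
  then have hom: "T homeomorphic_space ?P" unfolding homeomorphic_space_def by blast
  have sub: "f ` A = ?k -` A \<inter> ?X" if "A \<in> sets M" for A
    using sets.sets_into_space[OF that] k by (force simp: image_iff)
  have "sets (embed_measure M f) = {?k -` A \<inter> ?X | A. A \<in> sigma_sets (space M) {U. openin T U}}"
    unfolding sets_embed_measure'[OF inj] T(4)[unfolded T(3), symmetric] Setcompr_eq_image
    by (rule image_cong[OF refl sub])
  also have "\<dots> = sigma_sets ?X {?k -` A \<inter> ?X | A. A \<in> {U. openin T U}}"
    by (rule sigma_sets_vimage_commute) (auto simp: k)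
  also have "{?k -` A \<inter> ?X | A. A \<in> {U. openin T U}} = {U. openin ?P U}"
    unfolding openin_pullback_topology by auto
  finally show ?thesis
    unfolding standard_borel_def using homeomorphic_completely_metrizable_space[OF hom]
      homeomorphic_space_second_countability[OF hom] T(1,2) top
    by (intro exI[of _ ?P]) (auto simp: space_embed_measure)
qed

text \<open>The elements of \<open>G\<close> are renamed to natural numbers. This changes neither the orbit relations nor,
  therefore, the costs.\<close>

lemma multiplicativity_on_reals:
  fixes G :: "('a, 'b) monoid_scheme" and M :: "real measure"
  assumes "cost_minus_one_multiplicative" and "group G" and countable: "countable (carrier G)"
    and M: "standard_borel M" and pmp: "pmp_action G M act"
    and erg: "finitely_many_ergodic_components G M act" and free: "essentially_free G M act"
    and H: "finite_index G H"
  shows "cost (G\<lparr>carrier := H\<rparr>) M act - 1 = (cost G M act - 1) * ereal (real (subgroup_index G H))"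
proof -
  interpret group G by fact
  define c where "c = to_nat_on (carrier G)"
  define d where "d = inv_into (carrier G) c"
  have inj: "inj_on c (carrier G)" unfolding c_def using countable by (rule inj_on_to_nat_on)
  have dc [simp]: "d (c g) = g" if "g \<in> carrier G" for g
    unfolding d_def using inv_into_f_f[OF inj that] .
  define D :: "nat monoid" where
    "D = \<lparr>carrier = c ` carrier G, mult = (\<lambda>m n. c (d m \<otimes>\<^bsub>G\<^esub> d n)), one = c \<one>\<^bsub>G\<^esub>\<rparr>"
  have carD: "carrier D = c ` carrier G" and oneD: "\<one>\<^bsub>D\<^esub> = c \<one>\<^bsub>G\<^esub>"
    and multD: "\<And>g h. g \<in> carrier G \<Longrightarrow> h \<in> carrier G \<Longrightarrow> c g \<otimes>\<^bsub>D\<^esub> c h = c (g \<otimes>\<^bsub>G\<^esub> h)"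
    unfolding D_def by simp_all
  have gD: "group D"
  proof (rule groupI)
    fix x assume "x \<in> carrier D"
    then obtain g where g: "g \<in> carrier G" "x = c g" unfolding carD by blast
    then show "\<exists>y\<in>carrier D. y \<otimes>\<^bsub>D\<^esub> x = \<one>\<^bsub>D\<^esub>"
      unfolding carD by (intro bexI[of _ "c (inv\<^bsub>G\<^esub> g)"]) (simp_all add: multD oneD)
  qed (auto simp: carD oneD multD m_assoc)
  have invD: "inv\<^bsub>D\<^esub> (c g) = c (inv\<^bsub>G\<^esub> g)" if "g \<in> carrier G" for g
    using that by (intro group.inv_equality[OF gD]) (auto simp: carD oneD multD)
  define act' where "act' = (\<lambda>x n. act x (d n))"
  have act': "act' x (c g) = act x g" if "g \<in> carrier G" for x g unfolding act'_def using that by simp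
  have subH: "subgroup H G" and finH: "finite (rcosets\<^bsub>G\<^esub> H)" using H unfolding finite_index_def by auto
  have HG: "H \<subseteq> carrier G" using subH by (rule subgroup.subset)
  have coset: "c ` H #>\<^bsub>D\<^esub> c g = c ` (H #>\<^bsub>G\<^esub> g)" if "g \<in> carrier G" for g
    unfolding r_coset_def using HG that by (auto simp: multD subset_iff)
  have cosets: "rcosets\<^bsub>D\<^esub> (c ` H) = (`) c ` (rcosets\<^bsub>G\<^esub> H)"
    unfolding RCOSETS_def carD using coset by auto
  have "rcosets\<^bsub>G\<^esub> H \<subseteq> Pow (carrier G)" using rcosets_subset_PowG[OF subH] .
  then have "inj_on ((`) c) (rcosets\<^bsub>G\<^esub> H)" using inj_on_image_Pow[OF inj] inj_on_subset by blast
  then have idx: "subgroup_index D (c ` H) = subgroup_index G H"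
    unfolding subgroup_index_def cosets by (rule card_image)
  have "subgroup (c ` H) D"
  proof (rule group.subgroupI[OF gD])
    show "c ` H \<subseteq> carrier D" unfolding carD using HG by blast
    show "c ` H \<noteq> {}" using subgroup.one_closed[OF subH] by blast
    show "inv\<^bsub>D\<^esub> a \<in> c ` H" if a: "a \<in> c ` H" for a
      using a HG subgroup.m_inv_closed[OF subH] by (auto simp: invD subset_iff)
    show "a \<otimes>\<^bsub>D\<^esub> b \<in> c ` H" if "a \<in> c ` H" "b \<in> c ` H" for a b
      using that HG subgroup.m_closed[OF subH] by (auto simp: multD subset_iff)
  qed
  then have H': "finite_index D (c ` H)" unfolding finite_index_def cosets using finH by simp
  have "right_action D (space M) act'"
    using pmp unfolding pmp_action_def right_action_def carD oneD by (auto simp: multD act')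
  then have pmp': "pmp_action D M act'"
    using pmp unfolding pmp_action_def carD by (auto simp: act')
  have "invariant_sets D M act' = invariant_sets G M act"
    unfolding invariant_sets_def carD by (auto simp: act')
  then have erg': "finitely_many_ergodic_components D M act'"
    using erg unfolding finitely_many_ergodic_components_def by simp
  have stab: "{n \<in> carrier D. act' x n = x} = c ` {g \<in> carrier G. act x g = x}" for x
    unfolding carD by (auto simp: act')
  have free': "essentially_free D M act'"
    using free unfolding essentially_free_def oneD stab by eventually_elim simp
  have orb: "orbit_rel (D\<lparr>carrier := c ` K\<rparr>) M act' = orbit_rel (G\<lparr>carrier := K\<rparr>) M act"
    if "K \<subseteq> carrier G" for K
    unfolding orbit_rel_def using that by (auto simp: act' subset_iff)
  have "cost (D\<lparr>carrier := c ` H\<rparr>) M act' - 1 = (cost D M act' - 1) * ereal (real (subgroup_index D (c ` H)))"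
    using assms(1) gD M pmp' erg' free' H' unfolding cost_minus_one_multiplicative_def by blast
  moreover have "cost (D\<lparr>carrier := c ` H\<rparr>) M act' = cost (G\<lparr>carrier := H\<rparr>) M act"
    unfolding cost_def orb[OF HG] ..
  moreover have "orbit_rel D M act' = orbit_rel G M act"
    using orb[of "carrier G"] unfolding orbit_rel_def carD by simp
  then have "cost D M act' = cost G M act" unfolding cost_def by simp
  ultimately show ?thesis using idx by simp
qed

text \<open>The space is moved into the real numbers by \<open>f\<close>; all the premises and both costs move with it.\<close>

lemma multiplicativity_general:
  fixes G :: "('a, 'b) monoid_scheme" and M :: "'x measure" and f :: "'x \<Rightarrow> real"
  assumes "cost_minus_one_multiplicative" and "group G" and "countable (carrier G)"
    and inj: "inj_on f (space M)"
    and M: "standard_borel M" and pmp: "pmp_action G M act"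
    and erg: "finitely_many_ergodic_components G M act" and free: "essentially_free G M act"
    and H: "finite_index G H"
  shows "cost (G\<lparr>carrier := H\<rparr>) M act - 1 = (cost G M act - 1) * ereal (real (subgroup_index G H))"
proof -
  let ?X = "f ` space M"
  define N where "N = embed_measure M f"
  define k where "k = the_inv_into (space M) f"
  define act' where "act' = (\<lambda>y g. f (act (k y) g))"
  have kf: "k (f x) = x" if "x \<in> space M" for x unfolding k_def using the_inv_into_f_f[OF inj that] .
  have spN: "space N = ?X" unfolding N_def by (rule space_embed_measure)
  have fk: "f (k y) = y" "k y \<in> space M" if "y \<in> space N" for y using that kf unfolding spN by auto
  have f: "f \<in> M \<rightarrow>\<^sub>M N" unfolding N_def using inj by (rule measurable_embed_measure2')
  have distr: "distr M N f = N" unfolding N_def using embed_measure_eq_distr'[OF inj] by simp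
  have k: "k \<in> N \<rightarrow>\<^sub>M M"
  proof (rule measurableI)
    fix A assume A: "A \<in> sets M"
    have "k -` A \<inter> space N = f ` A"
      using sets.sets_into_space[OF A] kf unfolding spN by (force simp: image_iff)
    then show "k -` A \<inter> space N \<in> sets N" using A unfolding N_def by (simp add: in_sets_embed_measure)
  qed (rule fk)
  have distr': "distr N M k = M"
  proof -
    have "distr N M k = distr M M (k \<circ> f)" using distr_distr[OF k f] by (simp only: distr)
    also have "\<dots> = distr M M (\<lambda>x. x)" using kf by (intro distr_cong) auto
    finally show ?thesis by (simp add: distr_id)
  qed
  have action: "right_action G (space M) act" and prob: "prob_space M"
    and meas: "\<And>g. g \<in> carrier G \<Longrightarrow> (\<lambda>x. act x g) \<in> M \<rightarrow>\<^sub>M M"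
    and pres: "\<And>g. g \<in> carrier G \<Longrightarrow> distr M M (\<lambda>x. act x g) = M"
    using pmp unfolding pmp_action_def by auto
  have closed: "act x g \<in> space M" if "x \<in> space M" "g \<in> carrier G" for x g
    using action that unfolding right_action_def by blast
  have pmp': "pmp_action G N act'"
    unfolding pmp_action_def
  proof (intro conjI ballI)
    show "prob_space N" using prob_space.prob_space_distr[OF prob f] distr by simp
    show "right_action G (space N) act'"
      using action kf closed unfolding right_action_def spN act'_def by auto
    fix g assume g: "g \<in> carrier G"
    have comp: "(\<lambda>y. act' y g) = f \<circ> (\<lambda>x. act x g) \<circ> k" unfolding act'_def by auto
    show m: "(\<lambda>y. act' y g) \<in> N \<rightarrow>\<^sub>M N"
      unfolding comp using k meas[OF g] f by (intro measurable_comp)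
    have "distr N N (\<lambda>y. act' y g) = distr M N ((\<lambda>y. act' y g) \<circ> f)"
      using distr_distr[OF m f] by (simp only: distr)
    also have "\<dots> = distr M N (f \<circ> (\<lambda>x. act x g))" using kf by (intro distr_cong) (auto simp: act'_def)
    also have "\<dots> = distr (distr M M (\<lambda>x. act x g)) N f" by (rule distr_distr[OF f meas[OF g], symmetric])
    finally show "distr N N (\<lambda>y. act' y g) = N" by (simp add: pres[OF g] distr)
  qed
  have img: "f ` A = k -` A \<inter> space N" if "A \<subseteq> space M" for A
    using that kf unfolding spN by (force simp: image_iff)
  have em: "emeasure N B = emeasure M (f -` B \<inter> space M)" if "B \<in> sets N" for B
    using emeasure_embed_measure'[OF inj] that unfolding N_def by blast
  have inv_fwd: "f ` C \<in> invariant_sets G N act'" if "C \<in> invariant_sets G M act" for C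
  proof -
    have C: "C \<in> sets M" using that unfolding invariant_sets_def by blast
    then have CM: "C \<subseteq> space M" by (rule sets.sets_into_space)
    have "f ` C \<in> sets N" unfolding N_def using C by (rule in_sets_embed_measure)
    moreover have "y \<in> f ` C \<longleftrightarrow> k y \<in> C" if "y \<in> space N" for y
      using img[OF CM] that by auto
    ultimately show ?thesis
      using that closed kf fk unfolding invariant_sets_def act'_def spN by auto
  qed
  have inv_back: "f -` A \<inter> space M \<in> invariant_sets G M act" if A: "A \<in> invariant_sets G N act'" for A
  proof -
    have "f -` A \<inter> space M \<in> sets M" using A f measurable_sets unfolding invariant_sets_def by blast
    moreover have "f (act x g) \<in> A \<longleftrightarrow> f x \<in> A" if "x \<in> space M" "g \<in> carrier G" for x g
      using A that kf unfolding invariant_sets_def act'_def spN by auto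
    ultimately show ?thesis using closed unfolding invariant_sets_def by auto
  qed
  obtain \<C> where \<C>: "finite \<C>" "disjoint \<C>" "\<C> \<subseteq> invariant_sets G M act"
      "emeasure M (space M - \<Union>\<C>) = 0" "\<And>C. C \<in> \<C> \<Longrightarrow> emeasure M C \<noteq> 0"
      "\<And>C A. C \<in> \<C> \<Longrightarrow> A \<in> invariant_sets G M act \<Longrightarrow> emeasure M (C \<inter> A) = 0 \<or> emeasure M (C - A) = 0"
    using erg unfolding finitely_many_ergodic_components_def by blast
  have \<C>M: "C \<in> sets M" "C \<subseteq> space M" if "C \<in> \<C>" for C
  proof -
    show "C \<in> sets M" using \<C>(3) that unfolding invariant_sets_def by auto
    then show "C \<subseteq> space M" by (rule sets.sets_into_space)
  qed
  have fC: "f ` C \<in> sets N" if "C \<in> \<C>" for C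
    using \<C>M(1)[OF that] unfolding N_def by (rule in_sets_embed_measure)
  have vC: "f -` (f ` C) \<inter> space M = C" if "C \<in> \<C>" for C
    using \<C>M(2)[OF that] inj by (auto dest: inj_onD)
  have erg': "finitely_many_ergodic_components G N act'"
    unfolding finitely_many_ergodic_components_def
  proof (intro exI[of _ "(`) f ` \<C>"] conjI ballI)
    show "disjoint ((`) f ` \<C>)"
    proof (rule disjointI)
      fix a b assume "a \<in> (`) f ` \<C>" "b \<in> (`) f ` \<C>" "a \<noteq> b"
      then obtain C C' where C: "C \<in> \<C>" "C' \<in> \<C>" "a = f ` C" "b = f ` C'" "C \<noteq> C'" by blast
      then have "C \<inter> C' = {}" using \<C>(2) by (auto dest: disjointD)
      then show "a \<inter> b = {}"
        using C \<C>M(2) inj_on_image_Int[OF inj, of C C'] by simp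
    qed
    have "emeasure N (space N - \<Union>((`) f ` \<C>)) = emeasure M (f -` (space N - \<Union>((`) f ` \<C>)) \<inter> space M)"
      using fC \<C>(1) by (intro em sets.Diff sets.top sets.finite_Union) auto
    also have "f -` (space N - \<Union>((`) f ` \<C>)) \<inter> space M = space M - \<Union>\<C>"
      using vC unfolding spN by blast
    finally show "emeasure N (space N - \<Union>((`) f ` \<C>)) = 0" using \<C>(4) by simp
  next
    fix B assume "B \<in> (`) f ` \<C>"
    then obtain C where C: "C \<in> \<C>" "B = f ` C" by blast
    then show "emeasure N B \<noteq> 0" using em[OF fC[OF C(1)]] vC[OF C(1)] \<C>(5) by simp
    fix A assume A: "A \<in> invariant_sets G N act'"
    then have Am: "A \<in> sets N" unfolding invariant_sets_def by blast
    have "f -` (B \<inter> A) \<inter> space M = C \<inter> (f -` A \<inter> space M)"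
        "f -` (B - A) \<inter> space M = C - (f -` A \<inter> space M)"
      using vC[OF C(1)] \<C>M(2)[OF C(1)] unfolding C(2) by blast+
    then show "emeasure N (B \<inter> A) = 0 \<or> emeasure N (B - A) = 0"
      using em[of "B \<inter> A"] em[of "B - A"] Am fC[OF C(1)] C(2) \<C>(6)[OF C(1) inv_back[OF A]] by auto
  qed (use \<C>(1,3) inv_fwd in auto)
  have "AE x in distr N M k. {g \<in> carrier G. act x g = x} = {\<one>\<^bsub>G\<^esub>}"
    using free unfolding essentially_free_def distr' .
  then have stab_AE: "AE y in N. {g \<in> carrier G. act (k y) g = k y} = {\<one>\<^bsub>G\<^esub>}" by (rule AE_distrD[OF k])
  have stab: "{g \<in> carrier G. act' y g = y} = {g \<in> carrier G. act (k y) g = k y}" if "y \<in> space N" for y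
    unfolding act'_def using that fk closed kf by (metis (mono_tags, lifting))
  have free': "essentially_free G N act'"
    unfolding essentially_free_def using stab_AE AE_space by eventually_elim (simp add: stab)
  have "cost (G\<lparr>carrier := H\<rparr>) N act' - 1 = (cost G N act' - 1) * ereal (real (subgroup_index G H))"
  proof (rule multiplicativity_on_reals[OF assms(1-3) _ pmp' erg' free' H])
    show "standard_borel N" unfolding N_def by (rule standard_borel_embed_measure[OF M inj])
  qed
  moreover have cost_eq: "cost D M act = cost D N act'" if "carrier D \<subseteq> carrier G" for D :: "('a, 'b) monoid_scheme"
  proof (rule cost_eq_of_isomorphism[OF f k kf fk(1) distr])
    fix x y assume xy: "x \<in> space M" "y \<in> space M"
    have "f y = act' (f x) g \<longleftrightarrow> y = act x g" if "g \<in> carrier D" for g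
      unfolding act'_def kf[OF xy(1)] using kf closed xy that \<open>carrier D \<subseteq> carrier G\<close> by (metis subsetD)
    then show "(f x, f y) \<in> orbit_rel D N act' \<longleftrightarrow> (x, y) \<in> orbit_rel D M act"
      unfolding orbit_rel_def spN using xy by simp
  qed
  moreover have "H \<subseteq> carrier G" using H subgroup.subset unfolding finite_index_def by blast
  ultimately show ?thesis using cost_eq[of G] cost_eq[of "G\<lparr>carrier := H\<rparr>"] by simp
qed

section \<open>The boundary of a coset tree\<close>

locale coset_tree = group G for G (structure) +
  fixes \<Gamma> :: "nat \<Rightarrow> 'a set"
  assumes chain: "is_chain G \<Gamma>"
begin

abbreviation level :: "nat \<Rightarrow> 'a set set" where
  "level n \<equiv> rcosets (\<Gamma> n)"

abbreviation boundary :: "(nat \<Rightarrow> 'a set) set" where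
  "boundary \<equiv> tree_boundary G \<Gamma>"

definition cylinder :: "nat \<Rightarrow> 'a set set \<Rightarrow> (nat \<Rightarrow> 'a set) set" where
  "cylinder n E = {x \<in> boundary. x n \<in> E}"

text \<open>A shadow is a cylinder over a single vertex. Unlike shadows, cylinders form an algebra of sets.\<close>

definition cylinders :: "(nat \<Rightarrow> 'a set) set set" where
  "cylinders = {cylinder n E | n E. E \<subseteq> level n}"

lemma subgroup_chain: "subgroup (\<Gamma> n) G"
  and finite_level: "finite (level n)"
  and chain_step: "\<Gamma> (Suc n) \<subseteq> \<Gamma> n"
  using chain unfolding is_chain_def finite_index_def by auto

lemma chain_subset: "\<Gamma> n \<subseteq> carrier G"
  using subgroup_chain by (rule subgroup.subset)

lemma root_in_level: "\<Gamma> n \<in> level n"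
  using rcosetsI[OF chain_subset one_closed, of n] chain_subset by simp

lemma index_pos: "subgroup_index G (\<Gamma> n) > 0"
  unfolding subgroup_index_def using root_in_level finite_level card_gt_0_iff by blast

lemma boundary_level: "x \<in> boundary \<Longrightarrow> x n \<in> level n"
proof -
  assume "x \<in> boundary"
  then obtain g where "g \<in> carrier G" "x n = \<Gamma> n #> g"
    unfolding tree_boundary_def tree_edges_def by blast
  then show ?thesis using rcosetsI[OF chain_subset] by simp
qed

lemma boundary_step_determined:
  assumes "x \<in> boundary" "y \<in> boundary" "x (Suc n) = y (Suc n)"
  shows "x n = y n"
proof -
  obtain g where g: "g \<in> carrier G" "x n = \<Gamma> n #> g" "x (Suc n) = \<Gamma> (Suc n) #> g"
    using assms(1) unfolding tree_boundary_def tree_edges_def by blast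
  obtain h where h: "h \<in> carrier G" "y n = \<Gamma> n #> h" "y (Suc n) = \<Gamma> (Suc n) #> h"
    using assms(2) unfolding tree_boundary_def tree_edges_def by blast
  have "\<Gamma> (Suc n) #> g = \<Gamma> (Suc n) #> h" using assms(3) g(3) h(3) by simp
  then have "g \<otimes> inv h \<in> \<Gamma> n"
    using coset_eq_iff[OF subgroup_chain g(1) h(1)] chain_step by blast
  then have "\<Gamma> n #> g = \<Gamma> n #> h"
    using coset_eq_iff[OF subgroup_chain g(1) h(1)] by blast
  then show ?thesis using g(2) h(2) by simp
qed

text \<open>A vertex of a tree determines the path from the root to it.\<close>

lemma boundary_determined:
  assumes "x \<in> boundary" "y \<in> boundary" "x m = y m" "n \<le> m"
  shows "x n = y n"
  using assms(4,3) by (induction rule: inc_induct) (simp_all add: boundary_step_determined[OF assms(1,2)])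

text \<open>Cylinders of a given level are cylinders of every deeper level. This is what allows finitely many
  approximating cylinders to be put on a common level, and the estimates to hold for all deep levels.\<close>

lemma cylinder_lift:
  assumes "n \<le> m"
  shows "\<exists>F\<subseteq>level m. cylinder m F = cylinder n E"
proof (intro exI conjI)
  let ?F = "(\<lambda>x. x m) ` cylinder n E"
  show "?F \<subseteq> level m" unfolding cylinder_def using boundary_level by auto
  show "cylinder m ?F = cylinder n E"
  proof (intro equalityI subsetI)
    fix y assume "y \<in> cylinder m ?F"
    then obtain x where "y \<in> boundary" "x \<in> boundary" "x n \<in> E" "y m = x m"
      unfolding cylinder_def by auto
    then show "y \<in> cylinder n E"
      using boundary_determined[OF _ _ _ assms, of y x] unfolding cylinder_def by simp
  qed (auto simp: cylinder_def)
qed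

lemma shadow_eq_cylinder: "shadow G \<Gamma> n t = cylinder n {t}"
  unfolding shadow_def cylinder_def by simp

lemma cylinder_UN: "cylinder n E = (\<Union>t\<in>E \<inter> level n. shadow G \<Gamma> n t)"
  unfolding shadow_def cylinder_def using boundary_level by auto

lemma boundary_eq_cylinder: "boundary = cylinder 0 (level 0)"
  unfolding cylinder_def using boundary_level by auto

lemma cylinders_Pow: "cylinders \<subseteq> Pow boundary"
  unfolding cylinders_def cylinder_def by auto

lemma cylinders_countable: "countable cylinders"
proof -
  have "cylinders = (\<Union>n. cylinder n ` Pow (level n))" unfolding cylinders_def by auto
  moreover have "countable (\<Union>n. cylinder n ` Pow (level n))"
  proof (rule countable_UN)
    show "countable (cylinder n ` Pow (level n))" for n
      using finite_level[of n] by (intro countable_finite) simp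
  qed simp
  ultimately show ?thesis by simp
qed

lemma cylinders_Int_stable: "Int_stable cylinders"
proof (rule Int_stableI)
  fix A B assume "A \<in> cylinders" "B \<in> cylinders"
  then obtain m n E F where A: "A = cylinder m E" and B: "B = cylinder n F"
    unfolding cylinders_def by blast
  obtain E' where E': "E' \<subseteq> level (max m n)" "cylinder (max m n) E' = A"
    using cylinder_lift[of m "max m n" E] A by auto
  obtain F' where F': "F' \<subseteq> level (max m n)" "cylinder (max m n) F' = B"
    using cylinder_lift[of n "max m n" F] B by auto
  have "A \<inter> B = cylinder (max m n) (E' \<inter> F')" using E' F' unfolding cylinder_def by blast
  then show "A \<inter> B \<in> cylinders" unfolding cylinders_def using E'(1) by blast
qed

abbreviation level_product :: "(nat \<Rightarrow> 'a set) topology" where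
  "level_product \<equiv> product_topology (\<lambda>n. discrete_topology (level n)) UNIV"

lemma boundary_subset_product: "boundary \<subseteq> topspace level_product"
  using boundary_level by (auto simp: PiE_UNIV_domain)

text \<open>A basic open set of the product restricts finitely many coordinates, and on the boundary these are
  all determined by the last one.\<close>

lemma open_contains_shadow:
  assumes U: "openin (subtopology level_product boundary) U" and x: "x \<in> U"
  shows "\<exists>n. shadow G \<Gamma> n (x n) \<subseteq> U"
proof -
  obtain W where W: "openin level_product W" "U = W \<inter> boundary"
    using U by (auto simp: openin_subtopology)
  obtain Z where Z: "finite {i \<in> UNIV. Z i \<noteq> topspace (discrete_topology (level i))}"
      "x \<in> Pi\<^sub>E UNIV Z" "Pi\<^sub>E UNIV Z \<subseteq> W"
    using W x unfolding openin_product_topology_alt by blast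
  then obtain n where n: "{i \<in> UNIV. Z i \<noteq> topspace (discrete_topology (level i))} \<subseteq> {..n}"
    using finite_nat_iff_bounded_le by blast
  have "y \<in> U" if "y \<in> shadow G \<Gamma> n (x n)" for y
  proof -
    have y: "y \<in> boundary" "y n = x n" using that unfolding shadow_def by auto
    have xB: "x \<in> boundary" using W(2) x by blast
    have "y i \<in> Z i" for i
    proof (cases "i \<le> n")
      case True
      then have "y i = x i" using boundary_determined[OF y(1) xB y(2)] by blast
      then show ?thesis using Z(2) by auto
    next
      case False
      then have "Z i = level i" using n by auto
      then show ?thesis using boundary_level[OF y(1)] by simp
    qed
    then have "y \<in> W" using Z(3) by (auto simp: PiE_UNIV_domain)
    then show ?thesis using W(2) y(1) by blast
  qed
  then show ?thesis by blast
qed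

lemma shadow_open: "openin (subtopology level_product boundary) (shadow G \<Gamma> n t)"
proof -
  have "openin level_product {x \<in> topspace level_product. x n \<in> {t} \<inter> level n}"
    by (rule openin_continuous_map_preimage[OF continuous_map_product_projection]) auto
  moreover have "shadow G \<Gamma> n t = {x \<in> topspace level_product. x n \<in> {t} \<inter> level n} \<inter> boundary"
    unfolding shadow_def using boundary_subset_product boundary_level by auto
  ultimately show ?thesis unfolding openin_subtopology by blast
qed

text \<open>Presented as a subspace of a countable product of discrete spaces, in which it is closed, the boundary
  is seen to be Polish.\<close>

lemma boundary_topology_eq:
  "boundary_topology G \<Gamma> = subtopology level_product boundary"
proof (rule topology_eq[THEN iffD2], intro allI iffI)
  let ?S = "{shadow G \<Gamma> n t | n t. t \<in> level n}"
  fix U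
  show "openin (subtopology level_product boundary) U" if "openin (boundary_topology G \<Gamma>) U"
  proof (rule generate_topology_on_coarsest[OF istopology_openin _ openin_topology_generated_by])
    show "openin (topology_generated_by ?S) U" using that unfolding boundary_topology_def .
  qed (auto intro: shadow_open)
  show "openin (boundary_topology G \<Gamma>) U" if U: "openin (subtopology level_product boundary) U"
  proof -
    have UB: "U \<subseteq> boundary" using openin_subset[OF U] by simp
    have "\<exists>W. openin (boundary_topology G \<Gamma>) W \<and> x \<in> W \<and> W \<subseteq> U" if x: "x \<in> U" for x
    proof -
      obtain n where "shadow G \<Gamma> n (x n) \<subseteq> U" using open_contains_shadow[OF U x] by blast
      moreover have "x \<in> shadow G \<Gamma> n (x n)" "x n \<in> level n"
        using x UB boundary_level unfolding shadow_def by auto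
      moreover have "openin (boundary_topology G \<Gamma>) (shadow G \<Gamma> n (x n))"
        unfolding boundary_topology_def using \<open>x n \<in> level n\<close>
        by (intro topology_generated_by_Basis) blast
      ultimately show ?thesis by blast
    qed
    then show ?thesis by (subst openin_subopen) blast
  qed
qed

lemma topspace_boundary: "topspace (boundary_topology G \<Gamma>) = boundary"
  unfolding boundary_topology_eq topspace_subtopology using boundary_subset_product by blast

lemma boundary_closed: "closedin level_product boundary"
proof -
  let ?D = "\<lambda>n. discrete_topology (level n)"
  have "closedin level_product {x \<in> topspace level_product. (x n, x (Suc n)) \<in> tree_edges G \<Gamma> n}" for n
  proof (rule closedin_continuous_map_preimage)
    show "continuous_map level_product (prod_topology (?D n) (?D (Suc n))) (\<lambda>x. (x n, x (Suc n)))"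
      by (intro continuous_map_pairedI continuous_map_product_projection) auto
    show "closedin (prod_topology (?D n) (?D (Suc n))) (tree_edges G \<Gamma> n)"
      using rcosetsI[OF chain_subset]
      by (auto simp: tree_edges_def simp flip: prod_topology_discrete_topology)
  qed
  then have "closedin level_product
      (\<Inter>n. {x \<in> topspace level_product. (x n, x (Suc n)) \<in> tree_edges G \<Gamma> n})"
    by (intro closedin_Inter) auto
  moreover have "boundary = (\<Inter>n. {x \<in> topspace level_product. (x n, x (Suc n)) \<in> tree_edges G \<Gamma> n})"
    using boundary_subset_product unfolding tree_boundary_def by blast
  ultimately show ?thesis by simp
qed

lemma completely_metrizable_boundary: "completely_metrizable_space (boundary_topology G \<Gamma>)"
  unfolding boundary_topology_eq
  by (intro completely_metrizable_space_closedin boundary_closed)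
    (simp add: completely_metrizable_space_product_topology completely_metrizable_space_discrete_topology)

lemma shadows_countable: "countable {shadow G \<Gamma> n t | n t. t \<in> level n}"
proof -
  have "{shadow G \<Gamma> n t | n t. t \<in> level n} \<subseteq> cylinders"
    unfolding cylinders_def shadow_eq_cylinder by blast
  then show ?thesis using cylinders_countable countable_subset by blast
qed

lemma second_countable_boundary: "second_countable (boundary_topology G \<Gamma>)"
  unfolding second_countable_def
proof (intro exI conjI allI impI)
  show "countable {shadow G \<Gamma> n t | n t. t \<in> level n}" by (rule shadows_countable)
  show "\<forall>V\<in>{shadow G \<Gamma> n t | n t. t \<in> level n}. openin (boundary_topology G \<Gamma>) V"
    unfolding boundary_topology_eq using shadow_open by blast
  fix U x assume U: "openin (boundary_topology G \<Gamma>) U \<and> x \<in> U"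
  then obtain n where n: "shadow G \<Gamma> n (x n) \<subseteq> U"
    using open_contains_shadow unfolding boundary_topology_eq by blast
  have "x \<in> boundary" using U openin_subset[of "boundary_topology G \<Gamma>" U] topspace_boundary by blast
  then have "x \<in> shadow G \<Gamma> n (x n)" "x n \<in> level n" using boundary_level unfolding shadow_def by auto
  then show "\<exists>V\<in>{shadow G \<Gamma> n t | n t. t \<in> level n}. x \<in> V \<and> V \<subseteq> U" using n by blast
qed

text \<open>There are only countably many shadows, so every open set is a countable union of them. Cylinders
  are used as generators because they are closed under intersection.\<close>

lemma boundary_borel_sets:
  "sigma_sets boundary {U. openin (boundary_topology G \<Gamma>) U} = sigma_sets boundary cylinders"
proof (rule sigma_sets_eqI)
  interpret sigma_algebra boundary "sigma_sets boundary cylinders"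
    by (rule sigma_algebra_sigma_sets[OF cylinders_Pow])
  fix U assume "U \<in> {U. openin (boundary_topology G \<Gamma>) U}"
  then have U: "openin (boundary_topology G \<Gamma>) U" by simp
  have UB: "U \<subseteq> boundary" using openin_subset[OF U] topspace_boundary by blast
  let ?C = "{C \<in> {shadow G \<Gamma> n t | n t. t \<in> level n}. C \<subseteq> U}"
  have "countable ?C" by (rule countable_subset[OF _ shadows_countable]) blast
  moreover have "?C \<subseteq> sigma_sets boundary cylinders"
    unfolding shadow_eq_cylinder using cylinders_def by (auto intro!: sigma_sets.Basic)
  ultimately have "\<Union>?C \<in> sigma_sets boundary cylinders" by (rule countable_Union)
  moreover have "U \<subseteq> \<Union>?C"
  proof
    fix x assume x: "x \<in> U"
    then obtain n where "shadow G \<Gamma> n (x n) \<subseteq> U"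
      using open_contains_shadow U unfolding boundary_topology_eq by blast
    moreover have "x \<in> shadow G \<Gamma> n (x n)" "x n \<in> level n"
      using x UB boundary_level unfolding shadow_def by auto
    ultimately show "x \<in> \<Union>?C" by blast
  qed
  ultimately show "U \<in> sigma_sets boundary cylinders" by (metis (no_types, lifting) Sup_least mem_Collect_eq subset_antisym)
next
  fix C assume "C \<in> cylinders"
  then obtain n E where C: "C = cylinder n E" unfolding cylinders_def by blast
  have "openin (boundary_topology G \<Gamma>) C"
    unfolding C cylinder_UN boundary_topology_eq by (intro openin_Union) (auto intro: shadow_open)
  then show "C \<in> sigma_sets boundary {U. openin (boundary_topology G \<Gamma>) U}"
    by (intro sigma_sets.Basic) simp
qed

lemma boundary_right_action: "right_action G boundary (boundary_action G)"
  unfolding right_action_def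
proof (intro conjI ballI)
  note act = rcosets_action[OF subgroup_chain]
  fix x assume x: "x \<in> boundary"
  show "boundary_action G x \<one> = x"
    unfolding boundary_action_def using act_one[OF act boundary_level[OF x]] by blast
  fix g assume g: "g \<in> carrier G"
  show "boundary_action G x g \<in> boundary"
    unfolding tree_boundary_def boundary_action_def
  proof (intro CollectI allI)
    fix n
    obtain h where h: "h \<in> carrier G" "x n = \<Gamma> n #> h" "x (Suc n) = \<Gamma> (Suc n) #> h"
      using x unfolding tree_boundary_def tree_edges_def by blast
    then have "x n #> g = \<Gamma> n #> (h \<otimes> g)" "x (Suc n) #> g = \<Gamma> (Suc n) #> (h \<otimes> g)"
      using g chain_subset by (auto simp: coset_mult_assoc)
    then show "(x n #> g, x (Suc n) #> g) \<in> tree_edges G \<Gamma> n"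
      unfolding tree_edges_def using h(1) g by blast
  qed
  fix h assume h: "h \<in> carrier G"
  show "boundary_action G x (g \<otimes> h) = boundary_action G (boundary_action G x g) h"
    unfolding boundary_action_def using act_mult[OF act boundary_level[OF x] g h] by blast
qed

lemma boundary_action_level: "boundary_action G x g n = x n #> g"
  unfolding boundary_action_def by simp

lemma vimage_cylinder:
  assumes "g \<in> carrier G"
  shows "(\<lambda>x. boundary_action G x g) -` cylinder n E \<inter> boundary = cylinder n {t \<in> level n. t #> g \<in> E}"
proof -
  have "boundary_action G x g \<in> boundary" "x n \<in> level n" if "x \<in> boundary" for x
    using act_closed[OF boundary_right_action that assms] boundary_level[OF that] .
  then show ?thesis unfolding cylinder_def by (auto simp: boundary_action_def)
qed

text \<open>Translation permutes the vertices of a level; this is why the action preserves the measure.\<close>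

lemma translate_bij:
  assumes "g \<in> carrier G" "E \<subseteq> level n"
  shows "card {t \<in> level n. t #> g \<in> E} = card E"
proof (rule bij_betw_same_card[of "\<lambda>t. t #> g"])
  note act = rcosets_action[OF subgroup_chain, of n]
  show "bij_betw (\<lambda>t. t #> g) {t \<in> level n. t #> g \<in> E} E"
    by (rule bij_betw_byWitness[where f' = "\<lambda>t. t #> inv g"])
      (use assms act_inv[OF act] act_closed[OF act] in \<open>auto simp: subset_iff\<close>)
qed

end

section \<open>The boundary action is measure preserving and ergodic\<close>

locale measured_coset_tree = coset_tree +
  fixes M
  assumes boundary_measure: "is_boundary_measure G \<Gamma> M"
begin

sublocale prob_space M
  using boundary_measure unfolding is_boundary_measure_def by blast

lemma space_M: "space M = boundary"
  and sets_M: "sets M = sigma_sets boundary cylinders"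
  and measure_shadow: "t \<in> level n \<Longrightarrow> measure M (shadow G \<Gamma> n t) = 1 / subgroup_index G (\<Gamma> n)"
  using boundary_measure boundary_borel_sets unfolding is_boundary_measure_def by auto

lemma cylinder_sets [measurable]: "cylinder n E \<in> sets M"
proof -
  have "cylinder n E = cylinder n (E \<inter> level n)" unfolding cylinder_def using boundary_level by auto
  then have "cylinder n E \<in> cylinders" unfolding cylinders_def by blast
  then show ?thesis unfolding sets_M by (rule sigma_sets.Basic)
qed

lemma measure_cylinder:
  assumes "E \<subseteq> level n"
  shows "measure M (cylinder n E) = card E / subgroup_index G (\<Gamma> n)"
proof -
  have fin: "finite E" using assms finite_level finite_subset by blast
  have "cylinder n E = (\<Union>t\<in>E. shadow G \<Gamma> n t)" using cylinder_UN assms by (simp add: Int_absorb2)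
  also have "measure M \<dots> = (\<Sum>t\<in>E. measure M (shadow G \<Gamma> n t))"
    using fin by (intro finite_measure_finite_Union)
      (auto simp: shadow_eq_cylinder disjoint_family_on_def, auto simp: cylinder_def)
  also have "\<dots> = card E / subgroup_index G (\<Gamma> n)"
    using assms by (simp add: measure_shadow subset_iff)
  finally show ?thesis .
qed

lemma pmp_boundary: "pmp_action G M (boundary_action G)"
  unfolding pmp_action_def
proof (intro conjI ballI)
  show "prob_space M" by unfold_locales
  show "right_action G (space M) (boundary_action G)"
    unfolding space_M by (rule boundary_right_action)
  fix g assume g: "g \<in> carrier G"
  let ?f = "\<lambda>x. boundary_action G x g"
  show meas: "?f \<in> M \<rightarrow>\<^sub>M M"
  proof (rule measurable_sigma_sets[OF sets_M cylinders_Pow])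
    show "?f \<in> space M \<rightarrow> boundary"
      unfolding space_M using act_closed[OF boundary_right_action _ g] by blast
    fix C assume "C \<in> cylinders"
    then show "?f -` C \<inter> space M \<in> sets M"
      unfolding cylinders_def space_M by (auto simp: vimage_cylinder[OF g])
  qed
  have meas_eq: "emeasure (distr M M ?f) C = emeasure M C" if "C \<in> cylinders" for C
  proof -
    obtain n E where C: "C = cylinder n E" and E: "E \<subseteq> level n" using \<open>C \<in> cylinders\<close> unfolding cylinders_def by blast
    have "measure M (cylinder n {t \<in> level n. t #> g \<in> E}) = measure M (cylinder n E)"
      using measure_cylinder[OF E] measure_cylinder[of "{t \<in> level n. t #> g \<in> E}" n]
        translate_bij[OF g E] by auto
    then have "emeasure M (?f -` cylinder n E \<inter> space M) = emeasure M (cylinder n E)"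
      unfolding space_M vimage_cylinder[OF g] by (simp add: emeasure_eq_measure)
    then show ?thesis unfolding C using emeasure_distr[OF meas cylinder_sets] by simp
  qed
  show "distr M M ?f = M"
  proof (rule measure_eqI_generator_eq[OF cylinders_Int_stable cylinders_Pow meas_eq _ sets_M])
    show "sets (distr M M ?f) = sigma_sets boundary cylinders" using sets_M by simp
    show "range (\<lambda>_::nat. boundary) \<subseteq> cylinders"
      unfolding cylinders_def using boundary_eq_cylinder by auto
    then have "emeasure (distr M M ?f) boundary = emeasure M boundary" by (intro meas_eq) auto
    then show "emeasure (distr M M ?f) boundary \<noteq> \<infinity>" by simp
  qed auto
qed

text \<open>The sets approximable in measure by cylinders form a \<open>\<sigma>\<close>-algebra, since cylinders form an algebra.\<close>

lemma cylinder_approximation: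
  assumes "A \<in> sets M" "\<epsilon> > 0"
  shows "\<exists>n E. E \<subseteq> level n \<and> measure M (A - cylinder n E) < \<epsilon> \<and> measure M (cylinder n E - A) < \<epsilon>"
proof -
  let ?close = "\<lambda>A \<epsilon>. \<exists>n E. E \<subseteq> level n \<and> measure M (A - cylinder n E) < \<epsilon> \<and> measure M (cylinder n E - A) < \<epsilon>"
  have "A \<in> sigma_sets boundary cylinders" using assms(1) sets_M by simp
  then have "\<forall>\<epsilon>>0. ?close A \<epsilon>"
  proof induction
    case (Basic A)
    then obtain n E where "E \<subseteq> level n" "A = cylinder n E" unfolding cylinders_def by blast
    then show ?case by (metis Diff_cancel measure_empty)
  next
    case Empty
    have "cylinder 0 {} = {}" unfolding cylinder_def by simp
    then show ?case by (metis Diff_cancel measure_empty empty_subsetI)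
  next
    case (Compl A)
    show ?case
    proof (intro allI impI)
      fix \<epsilon> :: real assume "\<epsilon> > 0"
      then obtain n E where E: "E \<subseteq> level n" "measure M (A - cylinder n E) < \<epsilon>" "measure M (cylinder n E - A) < \<epsilon>"
        using Compl.IH by blast
      have "boundary - A - cylinder n (level n - E) = cylinder n E - A"
        unfolding cylinder_def using boundary_level by blast
      moreover have "cylinder n (level n - E) - (boundary - A) = A - cylinder n E"
        using sigma_sets_into_sp[OF cylinders_Pow Compl.hyps] unfolding cylinder_def using boundary_level by blast
      ultimately show "?close (boundary - A) \<epsilon>" using E by (metis Diff_subset)
    qed
  next
    case (Union A)
    have meas [measurable]: "A i \<in> sets M" for i using Union.hyps sets_M by simp
    show ?case
    proof (intro allI impI)
      fix \<epsilon> :: real assume \<epsilon>: "\<epsilon> > 0"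
      let ?U = "\<Union>i. A i" and ?P = "\<lambda>N. \<Union>i<N. A i"
      have "(\<lambda>N. measure M (?P N)) \<longlonglongrightarrow> measure M (\<Union>N. ?P N)"
        by (rule finite_Lim_measure_incseq) (auto simp: incseq_def, fastforce)
      moreover have "(\<Union>N. ?P N) = ?U" by auto
      ultimately have "(\<lambda>N. measure M (?P N)) \<longlonglongrightarrow> measure M ?U" by simp
      then have "eventually (\<lambda>N. measure M (?P N) > measure M ?U - \<epsilon> / 2) sequentially"
        using \<epsilon> by (intro order_tendstoD) auto
      then obtain N where N: "measure M (?P N) > measure M ?U - \<epsilon> / 2"
        using eventually_happens by fastforce
      define \<delta> where "\<delta> = \<epsilon> / (2 * (real N + 1))"
      have \<delta>: "\<delta> > 0" using \<epsilon> unfolding \<delta>_def by simp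
      have N\<delta>: "real N * \<delta> < \<epsilon> / 2" using \<epsilon> unfolding \<delta>_def by (simp add: field_simps)
      have "\<forall>i. \<exists>n E. E \<subseteq> level n \<and> measure M (A i - cylinder n E) < \<delta> \<and> measure M (cylinder n E - A i) < \<delta>"
        using Union.IH \<delta> by blast
      then obtain n E where nE: "\<And>i. E i \<subseteq> level (n i)" "\<And>i. measure M (A i - cylinder (n i) (E i)) < \<delta>"
          "\<And>i. measure M (cylinder (n i) (E i) - A i) < \<delta>"
        by metis
      obtain m where m: "\<And>i. i < N \<Longrightarrow> n i \<le> m"
        using bounded_nat_set_is_finite[of "n ` {..<N}"] finite_nat_set_iff_bounded_le[of "n ` {..<N}"] by auto
      have "\<forall>i. \<exists>F. i < N \<longrightarrow> F \<subseteq> level m \<and> cylinder m F = cylinder (n i) (E i)"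
        using cylinder_lift m by meson
      then obtain F where F: "\<And>i. i < N \<Longrightarrow> F i \<subseteq> level m"
          "\<And>i. i < N \<Longrightarrow> cylinder m (F i) = cylinder (n i) (E i)"
        by metis
      have cyl: "cylinder m (\<Union>i<N. F i) = (\<Union>i<N. cylinder m (F i))"
        unfolding cylinder_def by blast
      have "measure M (?U - cylinder m (\<Union>i<N. F i)) \<le>
          measure M ((?U - ?P N) \<union> (\<Union>i<N. A i - cylinder m (F i)))"
        by (rule finite_measure_mono) (auto simp: cyl)
      also have "\<dots> \<le> measure M (?U - ?P N) + measure M (\<Union>i<N. A i - cylinder m (F i))"
        by (rule measure_Un_le) auto
      also have "measure M (?U - ?P N) = measure M ?U - measure M (?P N)"
        by (rule finite_measure_Diff) auto
      also have "measure M (\<Union>i<N. A i - cylinder m (F i)) \<le> (\<Sum>i<N. measure M (A i - cylinder m (F i)))"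
        by (rule finite_measure_subadditive_finite) auto
      also have "\<dots> \<le> (\<Sum>i<N. \<delta>)" using nE(2) F(2) by (intro sum_mono) (simp add: less_imp_le)
      finally have 1: "measure M (?U - cylinder m (\<Union>i<N. F i)) < \<epsilon>" using N N\<delta> by simp
      have "measure M (cylinder m (\<Union>i<N. F i) - ?U) \<le> measure M (\<Union>i<N. cylinder m (F i) - A i)"
        by (rule finite_measure_mono) (auto simp: cyl)
      also have "\<dots> \<le> (\<Sum>i<N. measure M (cylinder m (F i) - A i))"
        by (rule finite_measure_subadditive_finite) auto
      also have "\<dots> \<le> (\<Sum>i<N. \<delta>)" using nE(3) F(2) by (intro sum_mono) (simp add: less_imp_le)
      finally have 2: "measure M (cylinder m (\<Union>i<N. F i) - ?U) < \<epsilon>" using N\<delta> \<epsilon> by simp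
      show "?close ?U \<epsilon>" using 1 2 F(1) by (intro exI[of _ m] exI[of _ "\<Union>i<N. F i"]) auto
    qed
  qed
  then show ?thesis using assms(2) by blast
qed

text \<open>The group acts transitively on each level, so an invariant set meets all shadows of a level in sets of
  the same measure.\<close>

lemma invariant_cylinder_independent:
  assumes A: "A \<in> invariant_sets G M (boundary_action G)" and E: "E \<subseteq> level n"
  shows "measure M (A \<inter> cylinder n E) = measure M A * measure M (cylinder n E)"
proof -
  have Am [measurable]: "A \<in> sets M"
    and inv: "\<And>g x. g \<in> carrier G \<Longrightarrow> x \<in> boundary \<Longrightarrow> boundary_action G x g \<in> A \<longleftrightarrow> x \<in> A"
    using A unfolding invariant_sets_def space_M by auto
  have AB: "A \<subseteq> boundary" using sets.sets_into_space[OF Am] space_M by simp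
  define c where "c = measure M (A \<inter> shadow G \<Gamma> n (\<Gamma> n))"
  have c: "measure M (A \<inter> shadow G \<Gamma> n t) = c" if t: "t \<in> level n" for t
  proof -
    obtain g where g: "g \<in> carrier G" "t = \<Gamma> n #> g" using t by (auto simp: RCOSETS_def)
    let ?f = "\<lambda>x. boundary_action G x g"
    have f: "?f \<in> M \<rightarrow>\<^sub>M M" "distr M M ?f = M" using pmp_boundary g(1) unfolding pmp_action_def by auto
    have inj: "s = \<Gamma> n" if "s \<in> level n" "s #> g = \<Gamma> n #> g" for s
      using act_inv(1)[OF rcosets_action[OF subgroup_chain]] that root_in_level g(1) by metis
    have "?f -` (A \<inter> cylinder n {t}) \<inter> space M = A \<inter> cylinder n {\<Gamma> n}"
    proof -
      have "?f -` (A \<inter> cylinder n {t}) \<inter> space M =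
          (?f -` A \<inter> boundary) \<inter> (?f -` cylinder n {t} \<inter> boundary)"
        unfolding space_M by blast
      also have "?f -` A \<inter> boundary = A" using inv[OF g(1)] AB by auto
      also have "?f -` cylinder n {t} \<inter> boundary = cylinder n {\<Gamma> n}"
        unfolding vimage_cylinder[OF g(1)] using inj g(2) root_in_level
        by (intro arg_cong[where f = "cylinder n"]) auto
      finally show ?thesis .
    qed
    then have "measure M (A \<inter> cylinder n {\<Gamma> n}) = measure (distr M M ?f) (A \<inter> cylinder n {t})"
      using measure_distr[OF f(1), of "A \<inter> cylinder n {t}"] by simp
    then show ?thesis unfolding c_def shadow_eq_cylinder using f(2) by simp
  qed
  have sum: "measure M (A \<inter> cylinder n E) = card E * c" if "E \<subseteq> level n" for E
  proof -
    have "finite E" using that finite_level finite_subset by blast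
    have "A \<inter> cylinder n E = (\<Union>t\<in>E. A \<inter> shadow G \<Gamma> n t)" using that unfolding cylinder_UN by auto
    also have "measure M \<dots> = (\<Sum>t\<in>E. measure M (A \<inter> shadow G \<Gamma> n t))"
      using \<open>finite E\<close> by (intro finite_measure_finite_Union)
        (auto simp: shadow_eq_cylinder disjoint_family_on_def, auto simp: cylinder_def)
    also have "\<dots> = card E * c" using that c by (simp add: subset_iff)
    finally show ?thesis .
  qed
  have "A \<inter> cylinder n (level n) = A" using AB boundary_level unfolding cylinder_def by auto
  then have "measure M A = subgroup_index G (\<Gamma> n) * c"
    using sum[of "level n"] unfolding subgroup_index_def by simp
  then show ?thesis using sum[OF E] measure_cylinder[OF E] index_pos[of n] by simp
qed

text \<open>Approximating \<open>A\<close> by cylinders, from which \<open>A\<close> is independent, shows that \<open>A\<close> is independent of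
  itself.\<close>

lemma invariant_trivial:
  assumes A: "A \<in> invariant_sets G M (boundary_action G)"
  shows "measure M A = 0 \<or> measure M A = 1"
proof -
  have Am [measurable]: "A \<in> sets M" using A unfolding invariant_sets_def by blast
  let ?a = "measure M A"
  have a: "0 \<le> ?a" "?a \<le> 1" by auto
  have "?a \<le> ?a * ?a + \<epsilon>" if eps: "\<epsilon> > 0" for \<epsilon>
  proof -
    obtain n E where E: "E \<subseteq> level n" "measure M (A - cylinder n E) < \<epsilon> / 2"
        "measure M (cylinder n E - A) < \<epsilon> / 2"
      using cylinder_approximation[OF Am half_gt_zero[OF eps]] by blast
    let ?C = "cylinder n E"
    have 1: "?a = measure M (A - ?C) + measure M (A \<inter> ?C)"
      using finite_measure_Diff'[of A ?C] by simp
    have 2: "measure M ?C = measure M (?C - A) + measure M (A \<inter> ?C)"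
      using finite_measure_Diff'[of ?C A] by (simp add: Int_commute)
    have "measure M (A \<inter> ?C) \<le> ?a" by (rule finite_measure_mono) auto
    then have "measure M ?C \<le> ?a + \<epsilon> / 2" using 2 E(3) by linarith
    then have "?a * measure M ?C \<le> ?a * (?a + \<epsilon> / 2)" using a by (intro mult_left_mono) auto
    also have "\<dots> \<le> ?a * ?a + \<epsilon> / 2"
      using a eps mult_right_mono[of ?a 1 "\<epsilon> / 2"] by (simp add: distrib_left)
    finally show ?thesis using 1 E(2) invariant_cylinder_independent[OF A E(1)] by linarith
  qed
  then have "?a \<le> ?a * ?a" by (rule field_le_epsilon)
  then show ?thesis using a by (cases "?a = 0") (auto simp: mult_le_cancel_left1)
qed

lemma finitely_many_components: "finitely_many_ergodic_components G M (boundary_action G)"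
  unfolding finitely_many_ergodic_components_def
proof (intro exI[of _ "{space M}"] conjI ballI)
  show "{space M} \<subseteq> invariant_sets G M (boundary_action G)"
    unfolding invariant_sets_def using act_closed[OF boundary_right_action] sets.top[of M] by (auto simp: space_M)
next
  fix C assume C: "C \<in> {space M}"
  show "emeasure M C \<noteq> 0" using C emeasure_space_1 by simp
  fix A assume A: "A \<in> invariant_sets G M (boundary_action G)"
  then have Am: "A \<in> sets M" unfolding invariant_sets_def by blast
  show "emeasure M (C \<inter> A) = 0 \<or> emeasure M (C - A) = 0"
    using invariant_trivial[OF A] C prob_compl[OF Am] sets.Int_space_eq1[OF Am]
    by (auto simp: emeasure_eq_measure)
qed (auto simp: disjoint_def)

text \<open>The levels separate the points of the boundary, so the graph is a countable intersection of finite
  unions of rectangles.\<close>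

lemma action_graph_measurable:
  assumes g: "g \<in> carrier G"
  shows "{(x, boundary_action G x g) | x. x \<in> space M} \<in> sets (M \<Otimes>\<^sub>M M)"
proof -
  let ?D = "\<Inter>n. \<Union>t\<in>level n. cylinder n {t} \<times> cylinder n {t #> g}"
  have "?D \<in> sets (M \<Otimes>\<^sub>M M)"
    by (intro sets.countable_INT image_subsetI sets.finite_UN finite_level pair_measureI cylinder_sets) auto
  moreover have "{(x, boundary_action G x g) | x. x \<in> space M} = ?D"
  proof (intro equalityI subsetI)
    fix p assume "p \<in> {(x, boundary_action G x g) | x. x \<in> space M}"
    then obtain x where x: "x \<in> boundary" "p = (x, boundary_action G x g)" using space_M by auto
    then show "p \<in> ?D"
      using act_closed[OF boundary_right_action x(1) g] boundary_level[OF x(1)]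
      unfolding cylinder_def by (auto simp: boundary_action_level)
  next
    fix p assume p: "p \<in> ?D"
    obtain x y where xy: "p = (x, y)" by fastforce
    have *: "x \<in> boundary \<and> y n = x n #> g" for n
      using p unfolding xy cylinder_def by auto
    then have "y = boundary_action G x g" unfolding boundary_action_def by blast
    then show "p \<in> {(x, boundary_action G x g) | x. x \<in> space M}" using * xy space_M by auto
  qed
  ultimately show ?thesis by simp
qed

lemma standard_borel_boundary: "standard_borel M"
  unfolding standard_borel_def
  using completely_metrizable_boundary second_countable_boundary topspace_boundary space_M sets_M
    boundary_borel_sets
  by (intro exI[of _ "boundary_topology G \<Gamma>"]) auto

end

section \<open>From spanning graphs to generators of deep subgroups\<close>

text \<open>Continuity of the measure from below. It reduces the countably many words to finitely many.\<close>

lemma (in prob_space) almost_covered_by_finite_subfamily: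
  assumes I: "countable I" and meas: "\<And>i. i \<in> I \<Longrightarrow> P i \<in> sets M"
    and cover: "AE x in M. \<exists>i\<in>I. x \<in> P i" and \<epsilon>: "\<epsilon> > 0"
  shows "\<exists>J\<subseteq>I. finite J \<and> measure M (space M - (\<Union>i\<in>J. P i)) < \<epsilon>"
proof -
  have "I \<noteq> {}" using cover AE_False by auto
  let ?p = "\<lambda>k. P (from_nat_into I k)" and ?Q = "\<lambda>N. \<Union>k<N. P (from_nat_into I k)"
  have m [measurable]: "?p k \<in> sets M" for k using meas from_nat_into[OF \<open>I \<noteq> {}\<close>] by blast
  have range: "(\<Union>k. ?p k) = (\<Union>i\<in>I. P i)"
    using range_from_nat_into[OF \<open>I \<noteq> {}\<close> I] by (metis image_image)
  have U: "(\<Union>N. ?Q N) = (\<Union>k. ?p k)" by auto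
  have "(\<lambda>N. measure M (?Q N)) \<longlonglongrightarrow> measure M (\<Union>N. ?Q N)"
    by (rule finite_Lim_measure_incseq) (auto simp: incseq_def, fastforce)
  moreover have "measure M (\<Union>k. ?p k) = 1"
  proof (rule prob_eq_1[THEN iffD2])
    show "(\<Union>k. ?p k) \<in> sets M" by auto
    show "AE x in M. x \<in> (\<Union>k. ?p k)" unfolding range using cover by simp
  qed
  ultimately have "(\<lambda>N. measure M (?Q N)) \<longlonglongrightarrow> 1" unfolding U by simp
  then have "eventually (\<lambda>N. measure M (?Q N) > 1 - \<epsilon>) sequentially"
    using \<epsilon> by (intro order_tendstoD) auto
  then obtain N where N: "measure M (?Q N) > 1 - \<epsilon>" using eventually_happens by fastforce
  have "measure M (space M - ?Q N) = 1 - measure M (?Q N)" by (rule prob_compl) auto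
  then have "measure M (space M - (\<Union>i\<in>from_nat_into I ` {..<N}. P i)) < \<epsilon>" using N by simp
  moreover have "from_nat_into I ` {..<N} \<subseteq> I" using from_nat_into[OF \<open>I \<noteq> {}\<close>] by blast
  ultimately show ?thesis by blast
qed

context measured_coset_tree
begin

abbreviation act :: "(nat \<Rightarrow> 'a set) \<Rightarrow> 'a \<Rightarrow> nat \<Rightarrow> 'a set" where
  "act \<equiv> boundary_action G"

lemma act_measurable: "g \<in> carrier G \<Longrightarrow> (\<lambda>x. act x g) \<in> M \<rightarrow>\<^sub>M M"
  and act_preserves: "g \<in> carrier G \<Longrightarrow> distr M M (\<lambda>x. act x g) = M"
  using pmp_boundary unfolding pmp_action_def by auto

lemma translate_sets: "g \<in> carrier G \<Longrightarrow> C \<in> sets M \<Longrightarrow> (\<lambda>x. act x g) -` C \<inter> boundary \<in> sets M"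
  using measurable_sets[OF act_measurable] space_M by metis

lemma measure_translate:
  assumes "g \<in> carrier G" "C \<in> sets M"
  shows "measure M ((\<lambda>x. act x g) -` C \<inter> boundary) = measure M C"
  using measure_distr[OF act_measurable[OF assms(1)] assms(2)] act_preserves[OF assms(1)] space_M by simp

text \<open>The edges \<open>(x, act x y)\<close> with \<open>y \<in> Y\<close> span the orbits of the subgroup generated by \<open>Y\<close>.\<close>

lemma cost_le_card_generators:
  assumes Y: "finite Y" "Y \<subseteq> carrier G"
  shows "cost (G\<lparr>carrier := generate G Y\<rparr>) M act \<le> ereal (card Y)"
proof -
  let ?E = "orbit_rel (G\<lparr>carrier := generate G Y\<rparr>) M act"
  define S where "S = (\<Union>y\<in>Y. {(x, act x y) | x. x \<in> space M})"
  have gen: "generate G Y \<subseteq> carrier G" using generate_in_carrier[OF Y(2)] by blast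
  have closed: "act x g \<in> boundary" if "x \<in> boundary" "g \<in> carrier G" for x g
    using act_closed[OF boundary_right_action that] .
  have "S \<in> sets (M \<Otimes>\<^sub>M M)"
    unfolding S_def using Y action_graph_measurable by (intro sets.finite_UN) auto
  moreover have "S \<subseteq> ?E"
  proof
    fix p assume "p \<in> S"
    then obtain x y where xy: "y \<in> Y" "x \<in> boundary" "p = (x, act x y)" unfolding S_def space_M by blast
    then have "y \<in> generate G Y" "act x y \<in> boundary" using Y(2) closed by (auto intro: generate.incl)
    then show "p \<in> ?E" unfolding orbit_rel_def space_M using xy by auto
  qed
  ultimately have 1: "borel_subgraph M ?E S" unfolding borel_subgraph_def by simp
  have path: "(x, act x g) \<in> (S \<union> S\<inverse>)\<^sup>*" if "g \<in> generate G Y" "x \<in> boundary" for x g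
    using that
  proof (induction g arbitrary: x rule: generate.induct)
    case one
    then show ?case using act_one[OF boundary_right_action] by simp
  next
    case (incl h)
    then have "(x, act x h) \<in> S" unfolding S_def space_M by blast
    then show ?case by blast
  next
    case (inv h)
    then have h: "h \<in> carrier G" using Y(2) by blast
    then have "act x (inv h) \<in> boundary" using inv closed by blast
    then have "(act x (inv h), act (act x (inv h)) h) \<in> S" using inv(1) unfolding S_def space_M by blast
    then have "(act x (inv h), x) \<in> S" using act_inv(2)[OF boundary_right_action inv(2) h] by simp
    then show ?case by blast
  next
    case (eng g h)
    then have c: "g \<in> carrier G" "h \<in> carrier G" using gen by auto
    have "(x, act x g) \<in> (S \<union> S\<inverse>)\<^sup>*" using eng by blast
    moreover have "(act x g, act (act x g) h) \<in> (S \<union> S\<inverse>)\<^sup>*" using eng closed c by blast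
    ultimately show ?case
      using act_mult[OF boundary_right_action eng.prems c] by (metis rtrancl_trans)
  qed
  have 2: "spans S ?E"
    unfolding spans_def orbit_rel_def space_M using path by auto
  have "out_degree S x \<le> card Y" for x
  proof -
    have sub: "{z. (x, z) \<in> S} \<subseteq> act x ` Y" unfolding S_def by auto
    then have "finite {z. (x, z) \<in> S}" using Y(1) finite_surj by blast
    moreover have "card {z. (x, z) \<in> S} \<le> card Y" using sub Y(1) by (rule surj_card_le[rotated])
    ultimately show ?thesis unfolding out_degree_def by (simp add: of_nat_le_iff)
  qed
  then have "edge_measure M S \<le> (\<integral>\<^sup>+x. of_nat (card Y) \<partial>M)"
    unfolding edge_measure_def by (intro nn_integral_mono) auto
  also have "\<dots> = of_nat (card Y)" by (simp add: emeasure_space_1)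
  finally have "(INF S\<in>{S. borel_subgraph M ?E S \<and> spans S ?E}. edge_measure M S) \<le> of_nat (card Y)"
    using 1 2 by (intro INF_lower2[of S]) simp_all
  then have "cost (G\<lparr>carrier := generate G Y\<rparr>) M act \<le> enn2ereal (of_nat (card Y))"
    unfolding cost_def less_eq_ennreal.rep_eq .
  then show ?thesis by (simp add: ennreal_of_nat_eq_real_of_nat enn2ereal_ennreal)
qed

definition edge_section :: "((nat \<Rightarrow> 'a set) \<times> 'a) set \<Rightarrow> 'a \<Rightarrow> (nat \<Rightarrow> 'a set) set" where
  "edge_section A g = {x \<in> boundary. (x, g) \<in> A}"

definition path_starts :: "((nat \<Rightarrow> 'a set) \<times> 'a) set \<Rightarrow> 'a list \<Rightarrow> (nat \<Rightarrow> 'a set) set" where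
  "path_starts A w = {x \<in> boundary. labelled_path G act A x w}"

lemma path_starts_Cons:
  assumes "g \<in> carrier G"
  shows "path_starts A (g # w) =
    (edge_section A g \<union> ((\<lambda>x. act x g) -` edge_section A (inv g) \<inter> boundary)) \<inter>
    ((\<lambda>x. act x g) -` path_starts A w \<inter> boundary)"
  using act_closed[OF boundary_right_action _ assms]
  unfolding path_starts_def edge_section_def by (auto simp: labelled_step_def)

lemma path_starts_sets:
  assumes "\<And>g. g \<in> carrier G \<Longrightarrow> edge_section A g \<in> sets M" "set w \<subseteq> carrier G"
  shows "path_starts A w \<in> sets M"
  using assms(2)
proof (induction w)
  case Nil
  have "path_starts A [] = space M" unfolding path_starts_def space_M by simp
  then show ?case by simp
next
  case (Cons g w)
  then have g: "g \<in> carrier G" and w: "path_starts A w \<in> sets M" by auto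
  show ?case
    unfolding path_starts_Cons[OF g] using g w assms(1)
    by (intro sets.Int sets.Un translate_sets) auto
qed

text \<open>Each letter of the word uses one of two edges, with label \<open>g\<close> forwards or \<open>inv g\<close> backwards. Both
  sets of starting points have moved by at most \<open>\<delta>\<close>, and translation to the position of the letter in the
  path does not change measures.\<close>

lemma measure_path_starts_Diff:
  assumes A: "\<And>g. g \<in> carrier G \<Longrightarrow> edge_section A g \<in> sets M"
    and B: "\<And>g. g \<in> carrier G \<Longrightarrow> edge_section B g \<in> sets M"
    and w: "set w \<subseteq> carrier G"
    and close: "\<And>g. g \<in> set w \<union> (\<lambda>g. inv g) ` set w \<Longrightarrow>
      measure M (edge_section A g - edge_section B g) \<le> \<delta>"
  shows "measure M (path_starts A w - path_starts B w) \<le> 2 * real (length w) * \<delta>"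
  using w close
proof (induction w)
  case Nil
  then show ?case unfolding path_starts_def by simp
next
  case (Cons g w)
  let ?f = "\<lambda>C. (\<lambda>x. act x g) -` C \<inter> boundary"
  have g: "g \<in> carrier G" and w: "set w \<subseteq> carrier G" using Cons.prems by auto
  have AB [measurable]: "edge_section A g \<in> sets M" "edge_section B g \<in> sets M"
      "edge_section A (inv g) \<in> sets M" "edge_section B (inv g) \<in> sets M"
      "path_starts A w \<in> sets M" "path_starts B w \<in> sets M"
    using A B g w path_starts_sets by auto
  let ?X = "edge_section A g - edge_section B g" and ?Y = "edge_section A (inv g) - edge_section B (inv g)"
    and ?Z = "path_starts A w - path_starts B w"
  have XYZ: "?X \<in> sets M" "?f ?Y \<in> sets M" "?f ?Z \<in> sets M"
    by (intro sets.Diff translate_sets[OF g] AB)+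
  have "measure M (path_starts A (g # w) - path_starts B (g # w)) \<le> measure M (?X \<union> ?f ?Y \<union> ?f ?Z)"
  proof (rule finite_measure_mono)
    show "path_starts A (g # w) - path_starts B (g # w) \<subseteq> ?X \<union> ?f ?Y \<union> ?f ?Z"
      unfolding path_starts_Cons[OF g] by blast
    show "?X \<union> ?f ?Y \<union> ?f ?Z \<in> sets M" using XYZ by blast
  qed
  also have "\<dots> \<le> measure M (?X \<union> ?f ?Y) + measure M (?f ?Z)"
    by (intro measure_Un_le sets.Un XYZ)
  also have "measure M (?X \<union> ?f ?Y) \<le> measure M ?X + measure M (?f ?Y)"
    by (intro measure_Un_le XYZ)
  also have "measure M (?f ?Y) = measure M ?Y" by (intro measure_translate[OF g] sets.Diff AB)
  also have "measure M (?f ?Z) = measure M ?Z" by (intro measure_translate[OF g] sets.Diff AB)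
  finally have "measure M (path_starts A (g # w) - path_starts B (g # w)) \<le>
      measure M ?X + measure M ?Y + measure M ?Z" by simp
  moreover have "measure M ?X \<le> \<delta>" "measure M ?Y \<le> \<delta>" by (intro Cons.prems(2), simp)+
  moreover have "measure M ?Z \<le> 2 * real (length w) * \<delta>"
    using w by (rule Cons.IH) (intro Cons.prems(2), auto)
  moreover have "2 * real (length (g # w)) * \<delta> = 2 * \<delta> + 2 * real (length w) * \<delta>"
    by (simp add: algebra_simps)
  ultimately show ?case by linarith
qed

definition labelled_edges :: "((nat \<Rightarrow> 'a set) \<times> (nat \<Rightarrow> 'a set)) set \<Rightarrow> ((nat \<Rightarrow> 'a set) \<times> 'a) set" where
  "labelled_edges S = {(x, g). x \<in> boundary \<and> g \<in> carrier G \<and> (x, act x g) \<in> S}"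

lemma edge_section_labelled_edges_sets:
  assumes "S \<in> sets (M \<Otimes>\<^sub>M M)" "g \<in> carrier G"
  shows "edge_section (labelled_edges S) g \<in> sets M"
proof -
  have graph: "(\<lambda>x. (x, act x g)) \<in> M \<rightarrow>\<^sub>M M \<Otimes>\<^sub>M M"
    by (intro measurable_Pair measurable_ident_sets refl act_measurable[OF assms(2)])
  have "edge_section (labelled_edges S) g = (\<lambda>x. (x, act x g)) -` S \<inter> space M"
    unfolding edge_section_def labelled_edges_def space_M using assms(2) by auto
  then show ?thesis using measurable_sets[OF graph assms(1)] by (simp only:)
qed

lemma graph_path_imp_labelled_path:
  assumes S: "S \<subseteq> orbit_rel G M act" and x: "x \<in> boundary" and "(x, y) \<in> (S \<union> S\<inverse>)\<^sup>*"
  shows "\<exists>w. set w \<subseteq> carrier G \<and> labelled_path G act (labelled_edges S) x w \<and> act x (word_value G w) = y"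
  using assms(3)
proof (induction rule: rtrancl_induct)
  case base
  then show ?case using act_one[OF boundary_right_action x] by (intro exI[of _ "[]"]) simp
next
  case (step y z)
  then obtain w where w: "set w \<subseteq> carrier G" "labelled_path G act (labelled_edges S) x w"
      "act x (word_value G w) = y" by blast
  have yB: "y \<in> boundary" using act_closed[OF boundary_right_action x, of "word_value G w"] w by simp
  obtain g where g: "g \<in> carrier G" "act y g = z" "labelled_step G act (labelled_edges S) y g"
  proof (cases "(y, z) \<in> S")
    case True
    then obtain g where "g \<in> carrier G" "z = act y g" using S unfolding orbit_rel_def by blast
    then show ?thesis using that[of g] True yB unfolding labelled_step_def labelled_edges_def by auto
  next
    case False
    then have zy: "(z, y) \<in> S" using step.hyps(2) by blast
    then obtain g where g: "g \<in> carrier G" "y = act z g" "z \<in> boundary"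
      using S space_M unfolding orbit_rel_def by blast
    then have "act y (inv g) = z" using act_inv(1)[OF boundary_right_action] by simp
    then show ?thesis using that[of "inv g"] g zy unfolding labelled_step_def labelled_edges_def by auto
  qed
  have "act x (word_value G (w @ [g])) = z"
    using act_mult[OF boundary_right_action x _ g(1), of "word_value G w"] w g by (simp add: word_value_append)
  moreover have "labelled_path G act (labelled_edges S) x (w @ [g])"
    using labelled_path_append[OF boundary_right_action x, of w "[g]"] w g by simp
  ultimately show ?case using w(1) g(1) by (intro exI[of _ "w @ [g]"]) simp
qed

text \<open>At a point with trivial stabilizer an edge determines its label.\<close>

lemma free_action_inj:
  assumes "{g \<in> carrier G. act x g = x} = {\<one>}" "x \<in> boundary" "g \<in> carrier G" "h \<in> carrier G"
    "act x g = act x h"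
  shows "g = h"
proof -
  have "act x (g \<otimes> inv h) = x"
    using act_mult[OF boundary_right_action assms(2,3)] act_inv(1)[OF boundary_right_action assms(2,4)] assms
    by simp
  then have "g \<otimes> inv h = \<one>" using assms by blast
  then show ?thesis using assms(3,4) by (metis inv_closed inv_equality inv_inv)
qed

text \<open>Freeness turns a path that ends in the right point into a path whose word has the right value.\<close>

lemma spanning_imp_labelled_paths:
  assumes free: "essentially_free G M act"
    and S: "borel_subgraph M (orbit_rel G M act) S" "spans S (orbit_rel G M act)"
    and g: "g \<in> carrier G"
  shows "AE x in M. \<exists>w\<in>{w \<in> lists (carrier G). word_value G w = g}. x \<in> path_starts (labelled_edges S) w"
  using free unfolding essentially_free_def using AE_space
proof eventually_elim
  fix x assume stab: "{g \<in> carrier G. act x g = x} = {\<one>}" and "x \<in> space M"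
  then have x: "x \<in> boundary" using space_M by simp
  have gx: "act x g \<in> boundary" using act_closed[OF boundary_right_action x g] .
  have "(x, act x g) \<in> (S \<union> S\<inverse>)\<^sup>*"
  proof (cases "x = act x g")
    case True
    then show ?thesis by simp
  next
    case False
    have "(x, act x g) \<in> orbit_rel G M act" unfolding orbit_rel_def using x gx g space_M by auto
    then show ?thesis using bspec[OF S(2)[unfolded spans_def], of "(x, act x g)"] False by simp
  qed
  then obtain w where w: "set w \<subseteq> carrier G" "labelled_path G act (labelled_edges S) x w"
      "act x (word_value G w) = act x g"
    using graph_path_imp_labelled_path[OF S(1)[unfolded borel_subgraph_def, THEN conjunct1] x] by metis
  then have "word_value G w = g" using free_action_inj[OF stab x _ g] by simp
  then show "\<exists>w\<in>{w \<in> lists (carrier G). word_value G w = g}. x \<in> path_starts (labelled_edges S) w"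
    using w(1,2) x unfolding path_starts_def by (intro bexI[of _ w]) auto
qed

text \<open>At a point with trivial stabilizer distinct labels lead to distinct neighbours, so the labels in \<open>F\<close>
  contribute at most the out-degree.\<close>

lemma sum_edge_sections_le:
  assumes free: "essentially_free G M act"
    and S: "borel_subgraph M (orbit_rel G M act) S"
    and F: "finite F" "F \<subseteq> carrier G"
    and c: "edge_measure M S \<le> ennreal c" "c \<ge> 0"
  shows "(\<Sum>g\<in>F. measure M (edge_section (labelled_edges S) g)) \<le> c"
proof -
  let ?A = "\<lambda>g. edge_section (labelled_edges S) g"
  have meas: "?A g \<in> sets M" if "g \<in> F" for g
    using edge_section_labelled_edges_sets S F(2) that unfolding borel_subgraph_def by blast
  have "ennreal (\<Sum>g\<in>F. measure M (?A g)) = (\<Sum>g\<in>F. emeasure M (?A g))"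
    by (simp add: emeasure_eq_measure sum_nonneg)
  also have "\<dots> = (\<Sum>g\<in>F. \<integral>\<^sup>+x. indicator (?A g) x \<partial>M)" using meas by (intro sum.cong) auto
  also have "\<dots> = (\<integral>\<^sup>+x. (\<Sum>g\<in>F. indicator (?A g) x) \<partial>M)"
    using meas by (intro nn_integral_sum[symmetric]) auto
  also have "\<dots> \<le> edge_measure M S"
    unfolding edge_measure_def
  proof (rule nn_integral_mono_AE)
    show "AE x in M. (\<Sum>g\<in>F. indicator (?A g) x) \<le> out_degree S x"
      using free unfolding essentially_free_def using AE_space
    proof eventually_elim
      fix x assume stab: "{g \<in> carrier G. act x g = x} = {\<one>}" and "x \<in> space M"
      then have x: "x \<in> boundary" using space_M by simp
      let ?L = "{g \<in> F. x \<in> ?A g}"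
      have "(\<Sum>g\<in>F. indicator (?A g) x :: ennreal) = of_nat (card ?L)"
        using F(1) by (simp add: indicator_def sum.If_cases Int_def)
      also have "\<dots> = of_nat (card (act x ` ?L))"
        using free_action_inj[OF stab x] F(2) by (subst card_image) (auto simp: inj_on_def subset_iff)
      also have "\<dots> = emeasure (count_space UNIV) (act x ` ?L)" using F(1) by simp
      also have "\<dots> \<le> out_degree S x"
        unfolding out_degree_def by (intro emeasure_mono) (auto simp: edge_section_def labelled_edges_def)
      finally show "(\<Sum>g\<in>F. indicator (?A g) x) \<le> out_degree S x" .
    qed
  qed
  also note c(1)
  finally show ?thesis using c(2) by (simp add: ennreal_le_iff)
qed

text \<open>A set of labelled edges that depends only on the coset of level \<open>m\<close> has the same paths upstairs and
  downstairs.\<close>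

lemma labelled_path_project:
  assumes "\<And>x g. x \<in> boundary \<Longrightarrow> g \<in> carrier G \<Longrightarrow> (x, g) \<in> A \<longleftrightarrow> (x m, g) \<in> E"
    and "x \<in> boundary" "set w \<subseteq> carrier G"
  shows "labelled_path G act A x w \<longleftrightarrow> labelled_path G (\<lambda>t g. t #> g) E (x m) w"
  using assms(2,3)
proof (induction w arbitrary: x)
  case (Cons g w)
  then have g: "g \<in> carrier G" and gx: "act x g \<in> boundary"
    using act_closed[OF boundary_right_action] by auto
  then show ?case
    using Cons assms(1)[of x g] assms(1)[of "act x g" "inv g"] Cons.IH[of "act x g"]
    by (simp add: labelled_step_def boundary_action_level[of x g m])
qed simp

lemma rank_quotient_from_level_graph:
  assumes S: "S \<subseteq> carrier G" "generate G S = carrier G"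
    and E: "finite E" "E \<subseteq> level m \<times> carrier G"
    and paths: "\<And>t s. t \<in> level m \<Longrightarrow> s \<in> S \<Longrightarrow>
      \<exists>w. set w \<subseteq> carrier G \<and> labelled_path G (\<lambda>t g. t #> g) E t w \<and> word_value G w = s"
  shows "rank_quotient G (\<Gamma> m) \<le> card E / subgroup_index G (\<Gamma> m) - 1"
proof -
  obtain Y where Y: "finite Y" "Y \<subseteq> \<Gamma> m" "generate G Y = \<Gamma> m" "card Y + card (level m) \<le> card E + 1"
    using subgroup_generators_from_graph[OF subgroup_chain finite_level E S paths] by blast
  have "min_generators (G\<lparr>carrier := \<Gamma> m\<rparr>) \<le> card Y"
    using min_generators_le[OF subgroup_chain Y(1-3)] .
  then have "real (min_generators (G\<lparr>carrier := \<Gamma> m\<rparr>)) - 1 \<le> real (card E) - subgroup_index G (\<Gamma> m)"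
    using Y(4) unfolding subgroup_index_def by linarith
  then have "rank_quotient G (\<Gamma> m) \<le> (real (card E) - subgroup_index G (\<Gamma> m)) / subgroup_index G (\<Gamma> m)"
    unfolding rank_quotient_def by (rule divide_right_mono) simp
  then show ?thesis using index_pos[of m] by (simp add: diff_divide_distrib)
qed

text \<open>The words are chosen first, as they determine how precise the approximation by cylinders must
  be: replacing the sections of \<open>A\<close> by cylinders that are \<open>\<delta>\<close>-close costs at most \<open>\<delta>\<close> additional edges per
  label, and for each generator spoils the paths on a set of measure at most \<open>\<epsilon>1 + L * \<delta>\<close>, where an
  edge labelled by that generator is added.\<close>

lemma rank_quotient_le_edge_measure:
  assumes fg: "finitely_generated G" and free: "essentially_free G M act"
    and S: "borel_subgraph M (orbit_rel G M act) S" "spans S (orbit_rel G M act)"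
    and c: "edge_measure M S \<le> ennreal c" "c \<ge> 0" and \<epsilon>: "\<epsilon> > 0"
  shows "\<exists>n. \<forall>m\<ge>n. rank_quotient G (\<Gamma> m) \<le> c - 1 + \<epsilon>"
proof -
  obtain K where K: "finite K" "K \<subseteq> carrier G" "generate G K = carrier G"
    using fg unfolding finitely_generated_def by blast
  define A where "A = labelled_edges S"
  have A_sets: "edge_section A g \<in> sets M" if "g \<in> carrier G" for g
    unfolding A_def using edge_section_labelled_edges_sets S(1) that unfolding borel_subgraph_def by blast
  define \<epsilon>1 where "\<epsilon>1 = \<epsilon> / (2 * (card K + 1))"
  have \<epsilon>1: "\<epsilon>1 > 0" unfolding \<epsilon>1_def using \<epsilon> by simp
  have "\<exists>J\<subseteq>{w \<in> lists (carrier G). word_value G w = s}.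
      finite J \<and> measure M (space M - (\<Union>w\<in>J. path_starts A w)) < \<epsilon>1" if s: "s \<in> carrier G" for s
  proof (rule almost_covered_by_finite_subfamily)
    have "countable (lists (carrier G))"
      using finitely_generated_imp_countable[OF fg] by (rule countable_lists)
    then show "countable {w \<in> lists (carrier G). word_value G w = s}" by (rule countable_subset[rotated]) blast
    show "path_starts A w \<in> sets M" if "w \<in> {w \<in> lists (carrier G). word_value G w = s}" for w
      using that A_sets by (intro path_starts_sets) (auto simp: in_lists_conv_set)
    show "AE x in M. \<exists>w\<in>{w \<in> lists (carrier G). word_value G w = s}. x \<in> path_starts A w"
      unfolding A_def by (rule spanning_imp_labelled_paths[OF free S s])
  qed (rule \<epsilon>1)
  then have "\<forall>s\<in>carrier G. \<exists>J. J \<subseteq> {w \<in> lists (carrier G). word_value G w = s} \<and>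
      finite J \<and> measure M (space M - (\<Union>w\<in>J. path_starts A w)) < \<epsilon>1"
    by simp
  from bchoice[OF this] obtain W where W_all: "\<forall>s\<in>carrier G.
      W s \<subseteq> {w \<in> lists (carrier G). word_value G w = s} \<and> finite (W s) \<and>
      measure M (space M - (\<Union>w\<in>W s. path_starts A w)) < \<epsilon>1" ..
  have W: "W s \<subseteq> {w \<in> lists (carrier G). word_value G w = s}" "finite (W s)"
      "measure M (space M - (\<Union>w\<in>W s. path_starts A w)) < \<epsilon>1" if "s \<in> carrier G" for s
    using bspec[OF W_all that] by simp_all
  have W_word: "set w \<subseteq> carrier G" "word_value G w = s" if "s \<in> K" "w \<in> W s" for s w
    using W(1)[of s] that K(2) by (auto simp: in_lists_conv_set)
  define WW where "WW = (\<Union>s\<in>K. W s)"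
  have WW: "finite WW" unfolding WW_def using K(1,2) W(2) by blast
  \<comment> \<open>Inverses are included because a letter may be realised by an edge traversed backwards.\<close>
  define F where "F = (\<Union>w\<in>WW. set w \<union> (\<lambda>g. inv g) ` set w)"
  have F: "finite F" "F \<subseteq> carrier G"
  proof -
    show "finite F" unfolding F_def by (intro finite_UN_I WW) simp
    show "F \<subseteq> carrier G" unfolding F_def WW_def using W_word(1) by auto
  qed
  define L where "L = (\<Sum>w\<in>WW. 2 * real (length w))"
  have L: "L \<ge> 0" unfolding L_def by (intro sum_nonneg) simp
  define D where "D = real (card F) + real (card K) * L"
  have D: "D \<ge> 0" unfolding D_def using L by simp
  \<comment> \<open>Adding \<open>1\<close> keeps the denominator positive when there are no labels.\<close>
  define \<delta> where "\<delta> = \<epsilon> / (2 * (D + 1))"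
  have \<delta>: "\<delta> > 0" unfolding \<delta>_def using \<epsilon> D by simp
  have "\<exists>n E. E \<subseteq> level n \<and> measure M (edge_section A g - cylinder n E) < \<delta> \<and>
      measure M (cylinder n E - edge_section A g) < \<delta>" if "g \<in> F" for g
    using cylinder_approximation[OF A_sets \<delta>] F(2) that by blast
  then obtain n E where nE: "\<And>g. g \<in> F \<Longrightarrow> E g \<subseteq> level (n g)"
      "\<And>g. g \<in> F \<Longrightarrow> measure M (edge_section A g - cylinder (n g) (E g)) < \<delta>"
      "\<And>g. g \<in> F \<Longrightarrow> measure M (cylinder (n g) (E g) - edge_section A g) < \<delta>"
    by metis
  obtain N where N: "\<And>g. g \<in> F \<Longrightarrow> n g \<le> N"
    using finite_nat_set_iff_bounded_le[of "n ` F"] F(1) by auto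
  have "rank_quotient G (\<Gamma> m) \<le> c - 1 + \<epsilon>" if m: "m \<ge> N" for m
  proof -
    let ?i = "real (subgroup_index G (\<Gamma> m))"
    have i: "?i > 0" using index_pos by simp
    have "\<exists>E'\<subseteq>level m. cylinder m E' = cylinder (n g) (E g)" if "g \<in> F" for g
      using cylinder_lift N[OF that] m by (meson le_trans)
    then obtain E' where E': "\<And>g. g \<in> F \<Longrightarrow> E' g \<subseteq> level m"
        "\<And>g. g \<in> F \<Longrightarrow> cylinder m (E' g) = cylinder (n g) (E g)"
      by metis
    \<comment> \<open>The approximating graph, downstairs on the cosets and upstairs on the boundary.\<close>
    define E0 where "E0 = (SIGMA g:F. E' g)\<inverse>"
    define B where "B = {(x, g). x \<in> boundary \<and> (x m, g) \<in> E0}"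
    have B_section: "edge_section B g = (if g \<in> F then cylinder m (E' g) else {})" for g
      unfolding edge_section_def B_def E0_def cylinder_def by auto
    have B_sets: "edge_section B g \<in> sets M" for g unfolding B_section by simp
    define bad where "bad s = {t \<in> level m. \<forall>w\<in>W s. \<not> labelled_path G (\<lambda>t g. t #> g) E0 t w}" for s
    have project: "labelled_path G act B x w \<longleftrightarrow> labelled_path G (\<lambda>t g. t #> g) E0 (x m) w"
      if "x \<in> boundary" "set w \<subseteq> carrier G" for x w
      by (rule labelled_path_project) (auto simp: B_def that)
    \<comment> \<open>Replacing \<open>A\<close> by \<open>B\<close> destroys few of the paths spelling one of the chosen words.\<close>
    have path_diff: "measure M (path_starts A w - path_starts B w) \<le> 2 * real (length w) * \<delta>"
      if s: "s \<in> K" "w \<in> W s" for s w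
    proof (rule measure_path_starts_Diff[OF A_sets B_sets W_word(1)[OF s]])
      fix g assume "g \<in> set w \<union> (\<lambda>g. inv g) ` set w"
      then have "g \<in> F" unfolding F_def WW_def using s by blast
      then show "measure M (edge_section A g - edge_section B g) \<le> \<delta>"
        unfolding B_section using nE(2) E'(2) by (simp add: less_imp_le)
    qed
    have bad: "card (bad s) \<le> ?i * (\<epsilon>1 + L * \<delta>)" if s: "s \<in> K" for s
    proof -
      let ?U = "\<Union>w\<in>W s. path_starts A w" and ?V = "\<Union>w\<in>W s. path_starts A w - path_starts B w"
      have sc: "s \<in> carrier G" using s K(2) by blast
      have PA: "path_starts A w \<in> sets M" "path_starts B w \<in> sets M" if "w \<in> W s" for w
        using path_starts_sets[OF A_sets] path_starts_sets[OF B_sets] W_word(1)[OF s that] by auto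
      have "bad s \<subseteq> level m" unfolding bad_def by blast
      then have card_eq: "card (bad s) = ?i * measure M (cylinder m (bad s))"
        using measure_cylinder[of "bad s" m] i by simp
      have "measure M (cylinder m (bad s)) \<le> measure M ((space M - ?U) \<union> ?V)"
      proof (rule finite_measure_mono)
        show "cylinder m (bad s) \<subseteq> (space M - ?U) \<union> ?V"
          unfolding cylinder_def bad_def path_starts_def space_M
          using project W_word(1)[OF s] by auto
        show "(space M - ?U) \<union> ?V \<in> sets M"
          using PA W(2)[OF sc] by (intro sets.Un sets.Diff sets.finite_UN sets.top) auto
      qed
      moreover have "measure M ((space M - ?U) \<union> ?V) \<le> measure M (space M - ?U) + measure M ?V"
        using PA W(2)[OF sc] by (intro measure_Un_le sets.Diff sets.finite_UN sets.top) auto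
      moreover have "measure M ?V \<le> (\<Sum>w\<in>W s. measure M (path_starts A w - path_starts B w))"
        using PA W(2)[OF sc] by (intro finite_measure_subadditive_finite) auto
      moreover have "\<dots> \<le> (\<Sum>w\<in>W s. 2 * real (length w) * \<delta>)"
        using path_diff[OF s] by (intro sum_mono)
      moreover have "\<dots> \<le> (\<Sum>w\<in>WW. 2 * real (length w) * \<delta>)"
        using WW s \<delta> by (intro sum_mono2) (auto simp: WW_def)
      moreover have "\<dots> = L * \<delta>" unfolding L_def by (simp add: sum_distrib_right)
      ultimately have "measure M (cylinder m (bad s)) \<le> \<epsilon>1 + L * \<delta>" using W(3)[OF sc] by linarith
      then show ?thesis unfolding card_eq using i by (intro mult_left_mono) auto
    qed
    \<comment> \<open>Cosets without a path for \<open>s\<close> receive the edge labelled \<open>s\<close>.\<close>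
    define E1 where "E1 = E0 \<union> (\<Union>s\<in>K. bad s \<times> {s})"
    have finE': "finite (E' g)" if "g \<in> F" for g
      using E'(1)[OF that] finite_level finite_subset by blast
    have finbad: "finite (bad s)" for s unfolding bad_def using finite_level by simp
    have E0: "finite E0" "E0 \<subseteq> level m \<times> carrier G"
      unfolding E0_def using F finE' E'(1) by auto
    have E1: "finite E1" "E1 \<subseteq> level m \<times> carrier G"
      unfolding E1_def using E0 K(1,2) finbad by (auto simp: bad_def)
    have "real (card E0) = (\<Sum>g\<in>F. real (card (E' g)))"
      unfolding E0_def using F(1) finE' by (simp add: card_SigmaI)
    also have "\<dots> \<le> (\<Sum>g\<in>F. ?i * (measure M (edge_section A g) + \<delta>))"
    proof (rule sum_mono)
      fix g assume g: "g \<in> F"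
      then have Ag: "edge_section A g \<in> sets M" using A_sets F(2) by blast
      have "real (card (E' g)) = ?i * measure M (cylinder m (E' g))"
        using measure_cylinder[OF E'(1)[OF g]] i by simp
      moreover have "measure M (cylinder m (E' g)) \<le>
          measure M (edge_section A g \<union> (cylinder m (E' g) - edge_section A g))"
        using Ag by (intro finite_measure_mono) auto
      moreover have "\<dots> \<le> measure M (edge_section A g) + measure M (cylinder m (E' g) - edge_section A g)"
        using Ag by (intro measure_Un_le) auto
      moreover have "measure M (cylinder m (E' g) - edge_section A g) < \<delta>" using nE(3)[OF g] E'(2)[OF g] by simp
      ultimately show "real (card (E' g)) \<le> ?i * (measure M (edge_section A g) + \<delta>)"
        using i by (simp add: mult_left_mono)
    qed
    also have "\<dots> = ?i * ((\<Sum>g\<in>F. measure M (edge_section A g)) + card F * \<delta>)"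
      by (simp add: sum_distrib_left[symmetric] sum.distrib)
    also have "\<dots> \<le> ?i * (c + card F * \<delta>)"
      using sum_edge_sections_le[OF free S(1) F c] i unfolding A_def by (intro mult_left_mono) auto
    finally have cardE0: "real (card E0) \<le> ?i * (c + card F * \<delta>)" .
    have "card (\<Union>s\<in>K. bad s \<times> {s}) \<le> (\<Sum>s\<in>K. card (bad s \<times> {s}))" using K(1) by (rule card_UN_le)
    also have "\<dots> = (\<Sum>s\<in>K. card (bad s))"
      by (intro sum.cong refl) (simp add: card_cartesian_product)
    finally have "real (card (\<Union>s\<in>K. bad s \<times> {s})) \<le> (\<Sum>s\<in>K. real (card (bad s)))"
      unfolding of_nat_sum[symmetric] of_nat_le_iff .
    also have "\<dots> \<le> (\<Sum>s\<in>K. ?i * (\<epsilon>1 + L * \<delta>))" using bad by (intro sum_mono)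
    finally have cardbad: "real (card (\<Union>s\<in>K. bad s \<times> {s})) \<le> ?i * (card K * (\<epsilon>1 + L * \<delta>))"
      by (simp add: algebra_simps)
    have "real (card E1) \<le> real (card E0) + real (card (\<Union>s\<in>K. bad s \<times> {s}))"
      unfolding E1_def of_nat_add[symmetric] of_nat_le_iff by (rule card_Un_le)
    also have "\<dots> \<le> ?i * (c + card F * \<delta>) + ?i * (card K * (\<epsilon>1 + L * \<delta>))"
      using cardE0 cardbad by linarith
    also have "\<dots> = ?i * (c + (card K * \<epsilon>1 + D * \<delta>))" unfolding D_def by (simp add: algebra_simps)
    also have "\<dots> \<le> ?i * (c + \<epsilon>)"
    proof -
      have "card K * \<epsilon>1 \<le> \<epsilon> / 2" unfolding \<epsilon>1_def using \<epsilon> by (simp add: field_simps)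
      moreover have "D * \<delta> \<le> \<epsilon> / 2" unfolding \<delta>_def using \<epsilon> D by (simp add: field_simps)
      ultimately show ?thesis using i by (intro mult_left_mono) auto
    qed
    finally have cardE1: "card E1 / ?i \<le> c + \<epsilon>" using i by (simp add: field_simps)
    have "\<exists>w. set w \<subseteq> carrier G \<and> labelled_path G (\<lambda>t g. t #> g) E1 t w \<and> word_value G w = s"
      if ts: "t \<in> level m" "s \<in> K" for t s
    proof (cases "t \<in> bad s")
      case True
      then have "labelled_path G (\<lambda>t g. t #> g) E1 t [s]"
        unfolding E1_def using ts(2) by (auto simp: labelled_step_def)
      then show ?thesis using ts(2) K(2) by (intro exI[of _ "[s]"]) auto
    next
      case False
      then obtain w where w: "w \<in> W s" "labelled_path G (\<lambda>t g. t #> g) E0 t w"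
        using ts(1) unfolding bad_def by blast
      then have "labelled_path G (\<lambda>t g. t #> g) E1 t w"
        by (intro labelled_path_mono[of E0 E1]) (auto simp: E1_def)
      then show ?thesis using W_word[OF ts(2) w(1)] by blast
    qed
    then show ?thesis
      using rank_quotient_from_level_graph[OF K(2,3) E1] cardE1 by fastforce
  qed
  then show ?thesis by blast
qed

text \<open>A ray is a sequence of elements of finite sets, hence is coded by a set of natural numbers.\<close>

lemma boundary_inj_real: "\<exists>f :: (nat \<Rightarrow> 'a set) \<Rightarrow> real. inj_on f boundary"
proof -
  obtain F :: "nat set \<Rightarrow> real" where F: "inj F"
    using nat_sets_eqpoll_reals unfolding eqpoll_def bij_betw_def by blast
  define code where "code x = {prod_encode (n, to_nat_on (level n) (x n)) | n. True}" for x
  have "inj_on code boundary"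
  proof (rule inj_onI)
    fix x y assume x: "x \<in> boundary" and y: "y \<in> boundary" and eq: "code x = code y"
    show "x = y"
    proof
      fix n
      have "prod_encode (n, to_nat_on (level n) (x n)) \<in> code y" using eq unfolding code_def by blast
      then have "to_nat_on (level n) (x n) = to_nat_on (level n) (y n)"
        unfolding code_def by (auto dest: inj_onD[OF inj_prod_encode])
      then show "x n = y n"
        using inj_on_to_nat_on[OF countable_finite[OF finite_level]] boundary_level[OF x] boundary_level[OF y]
        by (auto dest: inj_onD)
    qed
  qed
  then have "inj_on (F \<circ> code) boundary" using F by (intro comp_inj_on) (auto intro: inj_on_subset)
  then show ?thesis by blast
qed

end

section \<open>The rank gradient of a Farber chain\<close>

lemma rank_quotient_ge_minus_one: "rank_quotient G H \<ge> - 1"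
proof (cases "subgroup_index G H = 0")
  case False
  then have "- real (subgroup_index G H) \<le> real (min_generators (G\<lparr>carrier := H\<rparr>)) - 1" by linarith
  then show ?thesis using False unfolding rank_quotient_def by (simp add: field_simps)
qed (simp add: rank_quotient_def)

lemma absolute_rank_gradient_le: "finite_index G H \<Longrightarrow> absolute_rank_gradient G \<le> rank_quotient G H"
  unfolding absolute_rank_gradient_def
  by (rule cINF_lower) (auto intro!: bdd_belowI2 rank_quotient_ge_minus_one)

context measured_coset_tree
begin

lemma cost_nonneg_finite:
  assumes fg: "finitely_generated G"
  shows "\<exists>c\<ge>0. cost G M act = ereal c"
proof -
  obtain K where K: "finite K" "K \<subseteq> carrier G" "generate G K = carrier G"
    using fg unfolding finitely_generated_def by blast
  have "cost G M act \<le> ereal (card K)"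
    using cost_le_card_generators[OF K(1,2)] K(3) by simp
  moreover have "cost G M act \<ge> 0" unfolding cost_def by simp
  ultimately show ?thesis by (cases "cost G M act") auto
qed

text \<open>Compare \<open>cost H X \<le> d H\<close> with the multiplicativity formula for \<open>H\<close>.\<close>

lemma cost_minus_one_le_absolute_rank_gradient:
  assumes mult: "cost_minus_one_multiplicative" and fg: "finitely_generated G"
    and free: "essentially_free G M act" and c: "cost G M act = ereal c"
  shows "c - 1 \<le> absolute_rank_gradient G"
  unfolding absolute_rank_gradient_def
proof (rule cINF_greatest)
  show "{H. finite_index G H} \<noteq> {}" using chain unfolding is_chain_def by blast
  fix H assume "H \<in> {H. finite_index G H}"
  then have H: "finite_index G H" by simp
  then have subH: "subgroup H G" and "finite (rcosets H)" unfolding finite_index_def by auto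
  moreover have "H \<in> rcosets H" by (rule subgroup.subgroup_in_rcosets[OF subH is_group])
  ultimately have "card (rcosets H) > 0" using card_gt_0_iff by blast
  then have i: "real (subgroup_index G H) > 0" unfolding subgroup_index_def by simp
  obtain f :: "(nat \<Rightarrow> 'a set) \<Rightarrow> real" where f: "inj_on f (space M)" using boundary_inj_real space_M by auto
  have "cost (G\<lparr>carrier := H\<rparr>) M act - 1 = (cost G M act - 1) * ereal (subgroup_index G H)"
    by (rule multiplicativity_general[OF mult is_group finitely_generated_imp_countable[OF fg] f
        standard_borel_boundary pmp_boundary finitely_many_components free H])
  then have eq: "cost (G\<lparr>carrier := H\<rparr>) M act - 1 = ereal ((c - 1) * subgroup_index G H)"
    unfolding c by (simp add: one_ereal_def)
  obtain Z where Z: "finite Z" "Z \<subseteq> H" "generate G Z = H"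
    using finite_index_imp_finitely_generated[OF fg H] by metis
  obtain Y where Y: "finite Y" "Y \<subseteq> H" "generate G Y = H"
      "card Y = min_generators (G\<lparr>carrier := H\<rparr>)"
    using min_generators_attained[OF subH Z] by metis
  then have "cost (G\<lparr>carrier := H\<rparr>) M act \<le> ereal (min_generators (G\<lparr>carrier := H\<rparr>))"
    using cost_le_card_generators[of Y] subgroup.subset[OF subH] by auto
  then have "cost (G\<lparr>carrier := H\<rparr>) M act - 1 \<le> ereal (min_generators (G\<lparr>carrier := H\<rparr>)) - 1"
    by (rule ereal_minus_mono) simp
  also have "\<dots> = ereal (real (min_generators (G\<lparr>carrier := H\<rparr>)) - 1)"
    by (simp add: one_ereal_def)
  finally have "(c - 1) * real (subgroup_index G H) \<le> real (min_generators (G\<lparr>carrier := H\<rparr>)) - 1"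
    unfolding eq by (rule ereal_less_eq(3)[THEN iffD1])
  then show "c - 1 \<le> rank_quotient G H"
    unfolding rank_quotient_def by (rule pos_le_divide_eq[OF i, THEN iffD2])
qed

text \<open>The absolute rank gradient is a lower bound for all quotients, and the quotients are eventually less than
  \<open>c - 1 + \<epsilon>\<close>, where \<open>c - 1\<close> is at most the absolute rank gradient.\<close>

lemma rank_quotient_tendsto_absolute:
  assumes mult: "cost_minus_one_multiplicative" and fg: "finitely_generated G"
    and free: "essentially_free G M act"
  shows "(\<lambda>n. rank_quotient G (\<Gamma> n)) \<longlonglongrightarrow> absolute_rank_gradient G"
proof (rule LIMSEQ_I)
  fix \<epsilon> :: real assume \<epsilon>: "\<epsilon> > 0"
  obtain c where c: "c \<ge> 0" "cost G M act = ereal c" using cost_nonneg_finite[OF fg] by blast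
  let ?\<S> = "{S. borel_subgraph M (orbit_rel G M act) S \<and> spans S (orbit_rel G M act)}"
  have "(INF S\<in>?\<S>. edge_measure M S) = ennreal c"
    unfolding enn2ereal_inject[symmetric] enn2ereal_ennreal[OF c(1)] using c(2) unfolding cost_def .
  also have "\<dots> < ennreal (c + \<epsilon> / 3)" using c(1) \<epsilon> by (simp add: ennreal_less_iff)
  finally obtain S where S: "borel_subgraph M (orbit_rel G M act) S" "spans S (orbit_rel G M act)"
      "edge_measure M S < ennreal (c + \<epsilon> / 3)"
    unfolding INF_less_iff by blast
  obtain n where n: "\<And>m. m \<ge> n \<Longrightarrow> rank_quotient G (\<Gamma> m) \<le> c + \<epsilon> / 3 - 1 + \<epsilon> / 3"
    using rank_quotient_le_edge_measure[OF fg free S(1,2) less_imp_le[OF S(3)], of "\<epsilon> / 3"] c(1) \<epsilon> by auto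
  have "norm (rank_quotient G (\<Gamma> m) - absolute_rank_gradient G) < \<epsilon>" if "m \<ge> n" for m
  proof -
    have "absolute_rank_gradient G \<le> rank_quotient G (\<Gamma> m)"
      using chain unfolding is_chain_def by (intro absolute_rank_gradient_le) blast
    moreover have "rank_quotient G (\<Gamma> m) < absolute_rank_gradient G + \<epsilon>"
      using n[OF that] cost_minus_one_le_absolute_rank_gradient[OF mult fg free c(2)] \<epsilon> by linarith
    ultimately show ?thesis by simp
  qed
  then show "\<exists>n. \<forall>m\<ge>n. norm (rank_quotient G (\<Gamma> m) - absolute_rank_gradient G) < \<epsilon>" by blast
qed

end

lemma rank_gradient_farber_chain:
  assumes "cost_minus_one_multiplicative" "group G" "finitely_generated G" "farber_chain G \<Gamma>"
  shows "rank_gradient G \<Gamma> = absolute_rank_gradient G"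
proof -
  obtain M where M: "is_boundary_measure G \<Gamma> M" "essentially_free G M (boundary_action G)"
    using assms(4) unfolding farber_chain_def by blast
  interpret group G by fact
  interpret measured_coset_tree G \<Gamma> M
    using assms(4) M(1) by unfold_locales (auto simp: farber_chain_def)
  show ?thesis
    unfolding rank_gradient_def
    by (rule limI[OF rank_quotient_tendsto_absolute[OF assms(1,3) M(2)]])
qed

theorem theorem16:
  fixes G :: "('a, 'b) monoid_scheme" and \<Gamma> :: "nat \<Rightarrow> 'a set"
  assumes "cost_minus_one_multiplicative"
    and "group G"
    and "finitely_generated G"
    and "farber_chain G \<Gamma>"
  shows "rank_gradient G \<Gamma> = absolute_rank_gradient G \<and>
         (\<forall>\<Gamma>'. farber_chain G \<Gamma>' \<longrightarrow> rank_gradient G \<Gamma>' = rank_gradient G \<Gamma>)"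
  using rank_gradient_farber_chain[OF assms(1-3)] assms(4) by simp

end
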